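(* Let $d\geq 2$ and $1\leq l\leq d-1$, and let $\omega_1^{(1)},\ldots,\omega_1^{(l+1)},\omega_{l+1},\ldots,\omega_d$ be a basis of eigenvectors of the matrix $\mathfrak{H}^l_{d-1}$, where $\omega_1^{(i)}$, $1\leq i\leq l+1$, are eigenvectors for the eigenvalue $1$ and $\omega_j$ is an eigenvector for the eigenvalue $\frac{j!}{l!}$, $l+1\leq j\leq d$. (1) Let $\Delta$ be a $(d-1)$-dimensional simplicial complex. If we expand the $h$-vector of $\Delta$ in terms of eigenvectors of the matrix $\mathfrak{H}^l_{d-1}$, the coefficient of the eigenvector for the eigenvalue $\frac{d!}{l!}$ is non-zero. (2) The first and the last coordinate entry in $\omega_1^{(3)},\ldots,\omega_1^{(l+1)},\omega_{l+1},\ldots,\omega_d$ is zero. (3) The vectors $\omega_1^{(1)}$ and $\omega_1^{(2)}$ can be chosen such that $\omega_1^{(1)}=(1,i_1,\ldots,i_{d-1},0)$ and $\omega_1^{(2)}=(0,j_1,\ldots,j_{d-1},1)$. (4) The vector $\omega_d$ can be chosen such that $\omega_d=(0,b_1,\ldots,b_{d-1},0)$ for strictly positive rational numbers $b_i$, $1\leq i\leq d-1$.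
   Context: $\mathfrak{H}^l_{d-1}$ is the real $(d+1)\times(d+1)$ matrix, with rows and columns indexed by $0,\ldots,d$, of the linear transformation sending (as a column vector) the $h$-vector of a $(d-1)$-dimensional simplicial complex $\Delta$ to the $h$-vector of its $l$-th partial barycentric subdivision $\mathrm{sd}^l(\Delta)$. This is the subdivision of $\Delta$ in which only the faces of dimension $\geq l$ are barycentrically subdivided: its $(i-1)$-dimensional faces are indexed by chains $A_0\subset A_1\subset\cdots\subset A_r$ of faces of $\Delta$ with $0\leq \#A_0\leq l$, $\#A_1\geq l+1$ (if $r\geq 1$), $\#A_0+r=i$ and $A_r\in\Delta$. Explicitly, $(\mathfrak{H}^l_{d-1})_{ij}=A(d+1,i,d+1-j,l)$, with $A$ defined below. The matrix is diagonalizable with eigenvalue $1$ of multiplicity $l+1$ and eigenvalues $\frac{(l+1)!}{l!},\ldots,\frac{d!}{l!}$ of multiplicity $1$. The $h$-vector $(h_0^\Delta,\ldots,h_d^\Delta)$ of $\Delta$ is defined by $\sum_{i=0}^d f^\Delta_{i-1}(x-1)^{d-i}=\sum_{i=0}^d h_i^\Delta x^{d-i}$, where $f_i^\Delta$ is the number of $i$-dimensional faces of $\Delta$ ($f_{-1}^\Delta=1$). For $1\leq l\leq m-1$, $S_m^l$ is the set of permutations $\sigma$ of $[m]=\{1,\ldots,m\}$ with $\sigma(1)>\cdots>\sigma(l)$; for $\sigma\in S_m^l$, $\mathrm{des}^l(\sigma)$ is the number of $i\in[m-1]$ such that either $i\in[l]$ and $\sigma(i)>\sigma(l+1)$, or $i\in[m-1]\setminus[l]$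 and $\sigma(i)>\sigma(i+1)$; and $A(m,i,k,l)$ is the number of $\sigma\in S_m^l$ with $\mathrm{des}^l(\sigma)=i$ and $\sigma(m)=k$.
   Formalization: In (2), the zero first and last entries of ω_1^(3),…,ω_1^(l+1) are proved for a suitable choice of basis (the same as in (3) and (4)), not for every basis: for l≥2 replacing ω_1^(3) by ω_1^(3)+ω_1^(1) refutes the literal claim. *)

theory Defs
  imports
    "HOL-Combinatorics.Permutations"
    "HOL-Computational_Algebra.Polynomial"
    "Jordan_Normal_Form.VS_Connect"
    "Jordan_Normal_Form.Char_Poly"
begin

definition simplicial_complex :: "'a set set \<Rightarrow> bool" where
  "simplicial_complex \<Delta> \<longleftrightarrow>
     finite \<Delta> \<and> {} \<in> \<Delta> \<and> (\<forall>A\<in>\<Delta>. finite A) \<and> (\<forall>A\<in>\<Delta>. \<forall>B. B \<subseteq> A \<longrightarrow> B \<in> \<Delta>)"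

definition face_dim :: "'a set \<Rightarrow> int" where
  "face_dim A = int (card A) - 1"

definition complex_dim :: "'a set set \<Rightarrow> int" where
  "complex_dim \<Delta> = Max (face_dim ` \<Delta>)"

definition f_number :: "'a set set \<Rightarrow> int \<Rightarrow> nat" where
  "f_number \<Delta> i = card {A \<in> \<Delta>. face_dim A = i}"

text \<open>
  The \<open>f\<close>-polynomial in the shifted variable: the sum over \<open>i = 0..d\<close> of
  \<open>f_number \<Delta> (i - 1) * (x - 1) ^ (d - i)\<close>.
  The entry \<open>h_i\<close> of the \<open>h\<close>-vector is its coefficient at \<open>x ^ (d - i)\<close>.
\<close>

definition shifted_f_poly :: "nat \<Rightarrow> 'a set set \<Rightarrow> real poly" where
  "shifted_f_poly d \<Delta> =
     (\<Sum>i=0..d. smult (real (f_number \<Delta> (int i - 1))) ([:-1, 1:] ^ (d - i)))"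

definition h_vector :: "nat \<Rightarrow> 'a set set \<Rightarrow> real vec" where
  "h_vector d \<Delta> = vec (d + 1) (\<lambda>i. coeff (shifted_f_poly d \<Delta>) (d - i))"

lemma h_vector_identity:
  "(\<Sum>i=0..d. real (f_number \<Delta> (int i - 1)) * (x - 1) ^ (d - i)) =
   (\<Sum>i=0..d. (h_vector d \<Delta> $ i) * x ^ (d - i))"
proof -
  let ?p = "shifted_f_poly d \<Delta>"
  have "degree (smult (real (f_number \<Delta> (int i - 1))) ([:-1, 1:] ^ (d - i)) :: real poly) \<le> d" for i
  proof -
    have "degree ([:-1, 1:] ^ (d - i) :: real poly) \<le> degree ([:-1, 1:] :: real poly) * (d - i)"
      by (rule degree_power_le)
    also have "\<dots> \<le> d" by simp
    finally show ?thesis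
      using degree_smult_le le_trans by blast
  qed
  then have deg: "degree ?p \<le> d"
    unfolding shifted_f_poly_def by (intro degree_sum_le) auto
  have "(\<Sum>i=0..d. real (f_number \<Delta> (int i - 1)) * (x - 1) ^ (d - i)) = poly ?p x"
    by (simp add: shifted_f_poly_def poly_sum poly_power)
  also have "\<dots> = (\<Sum>i\<le>d. coeff ?p i * x ^ i)"
    unfolding poly_altdef using deg
    by (intro sum.mono_neutral_left) (auto simp: coeff_eq_0)
  also have "\<dots> = (\<Sum>i=0..d. coeff ?p (d - i) * x ^ (d - i))"
    by (rule sum.reindex_bij_witness[where i = "\<lambda>i. d - i" and j = "\<lambda>i. d - i"]) auto
  also have "\<dots> = (\<Sum>i=0..d. (h_vector d \<Delta> $ i) * x ^ (d - i))"
    by (intro sum.cong) (auto simp: h_vector_def)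
  finally show ?thesis .
qed

definition perms_l :: "nat \<Rightarrow> nat \<Rightarrow> (nat \<Rightarrow> nat) set" where
  "perms_l m l = {\<sigma>. \<sigma> permutes {1..m} \<and> (\<forall>i\<in>{1..<l}. \<sigma> i > \<sigma> (i + 1))}"

definition des_l :: "nat \<Rightarrow> nat \<Rightarrow> (nat \<Rightarrow> nat) \<Rightarrow> nat" where
  "des_l m l \<sigma> =
     card {i \<in> {1..m - 1}. (i \<in> {1..l} \<and> \<sigma> i > \<sigma> (l + 1)) \<or> (i \<notin> {1..l} \<and> \<sigma> i > \<sigma> (i + 1))}"

definition A_number :: "nat \<Rightarrow> nat \<Rightarrow> nat \<Rightarrow> nat \<Rightarrow> nat" where
  "A_number m i k l = card {\<sigma> \<in> perms_l m l. des_l m l \<sigma> = i \<and> \<sigma> m = k}"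

text \<open>
  \<open>H_matrix d l\<close> is the matrix of the transformation of \<open>h\<close>-vectors of
  \<open>(d - 1)\<close>-dimensional complexes under the \<open>l\<close>-th partial barycentric subdivision,
  given by its explicit entries.
\<close>

definition H_matrix :: "nat \<Rightarrow> nat \<Rightarrow> real mat" where
  "H_matrix d l = mat (d + 1) (d + 1) (\<lambda>(i, j). real (A_number (d + 1) i (d + 1 - j) l))"

text \<open>
  A basis of eigenvectors is given by two families: \<open>w k\<close> for \<open>k = 1..l+1\<close> (eigenvalue \<open>1\<close>)
  and \<open>v j\<close> for \<open>j = l+1..d\<close> (eigenvalue \<open>j! / l!\<close>); other values of \<open>w\<close> and \<open>v\<close> are
  irrelevant.  As \<open>basis\<close> speaks about sets, distinctness of the family is required separately.
\<close>

definition eigenbasis :: "nat \<Rightarrow> nat \<Rightarrow> (nat \<Rightarrow> real vec) \<Rightarrow> (nat \<Rightarrow> real vec) \<Rightarrow> bool" where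
  "eigenbasis d l w v \<longleftrightarrow>
     (\<forall>k\<in>{1..l + 1}. eigenvector (H_matrix d l) (w k) 1) \<and>
     (\<forall>j\<in>{l + 1..d}. eigenvector (H_matrix d l) (v j) (fact j / fact l)) \<and>
     distinct (map w [1..<l + 2] @ map v [l + 1..<d + 1]) \<and>
     vectorspace.basis class_ring (module_vec TYPE(real) (d + 1))
       (set (map w [1..<l + 2] @ map v [l + 1..<d + 1]))"

end

theory Submission
  imports Defs
begin

text \<open>
  The whole argument rests on three features of the matrix \<open>H_matrix d l\<close>, all read off from the
  permutations counted by its entries.

  First, there is exactly one permutation without descents and exactly one with the maximal number
  \<open>d\<close> of them, and they end in \<open>d + 1\<close> and in \<open>1\<close> (\<open>A_number_zero\<close>, \<open>A_number_top\<close>).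
  So the first and the last row of the matrix are unit vectors, and an eigenvector for an eigenvalue
  other than \<open>1\<close> has outer coordinates zero (\<open>eigenvector_ends_zero\<close>). This settles (2) for the
  eigenvectors \<open>v j\<close>. It also shows that the eigenspace for \<open>1\<close> is mapped onto the plane by taking
  the outer coordinates, so a basis of it can be changed to one with the outer coordinates \<open>(1, 0)\<close>,
  \<open>(0, 1)\<close> and \<open>(0, 0)\<close> otherwise, which is (3) and the rest of (2) (\<open>exchange_eigenbasis\<close>).

  Second, all columns of the matrix have the same sum, because exchanging the values \<open>k\<close> and \<open>k + 1\<close>
  identifies the permutations ending in \<open>k\<close> with those ending in \<open>k + 1\<close> (\<open>sum_A_number_indep\<close>).
  Hence the sum of the coordinates is a left eigenvector. For a nonnegative matrix the common column sum
  bounds all eigenvalues, and it must be one of them, so it equals \<open>d! / l!\<close> (\<open>column_sum_eq\<close>).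
  The sum of the coordinates therefore vanishes on all eigenvectors for smaller eigenvalues. On an
  \<open>h\<close>-vector it is the number of faces of dimension \<open>d - 1\<close>, which is positive. This proves (1).

  Third, the block of the matrix inside the outer rows and columns is strictly positive
  (\<open>A_number_interior_pos\<close>). The rational matrix has a rational eigenvector for the common column sum, its
  outer coordinates vanish, and by the argument of Perron its inner coordinates are nonzero and of one
  sign (\<open>positive_rational_eigenvector_exists\<close>). This is (4). Its coordinate sum is positive, so the
  vector \<open>v d\<close> occurs in its expansion and it can take the place of \<open>v d\<close> in the basis.
\<close>

section \<open>Permutations and their descents\<close>

text \<open>
  A permutation is determined by the relative order of its values: \<open>\<sigma> i\<close> is the rank of
  \<open>\<sigma> i\<close> among all values. Extreme descent numbers fix this relative order, which is how
  uniqueness of a permutation is shown below.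
\<close>

lemma permutes_value_eq_card:
  fixes \<sigma> :: "nat \<Rightarrow> nat"
  assumes "\<sigma> permutes {1..m}" "i \<in> {1..m}"
  shows "\<sigma> i = card {j \<in> {1..m}. \<sigma> j \<le> \<sigma> i}"
proof -
  have "\<sigma> i \<le> m"
    using permutes_in_image[OF assms(1), of i] assms(2) by simp
  have "\<sigma> ` {j \<in> {1..m}. \<sigma> j \<le> \<sigma> i} = {x \<in> \<sigma> ` {1..m}. x \<le> \<sigma> i}"
    by blast
  also have "\<dots> = {1..\<sigma> i}"
    using \<open>\<sigma> i \<le> m\<close> unfolding permutes_image[OF assms(1)] by auto
  finally have "card (\<sigma> ` {j \<in> {1..m}. \<sigma> j \<le> \<sigma> i}) = \<sigma> i"
    by simp
  moreover have "inj_on \<sigma> {j \<in> {1..m}. \<sigma> j \<le> \<sigma> i}"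
    using permutes_inj[OF assms(1)] by (rule inj_on_subset) simp
  ultimately show ?thesis
    by (simp add: card_image)
qed

lemma permutes_eqI_order:
  fixes \<sigma> \<tau> :: "nat \<Rightarrow> nat"
  assumes \<sigma>: "\<sigma> permutes {1..m}" and \<tau>: "\<tau> permutes {1..m}"
    and less: "\<And>i j. 1 \<le> i \<Longrightarrow> i < j \<Longrightarrow> j \<le> m \<Longrightarrow> \<sigma> i < \<sigma> j \<longleftrightarrow> \<tau> i < \<tau> j"
  shows "\<sigma> = \<tau>"
proof
  have inj: "\<sigma> i = \<sigma> j \<longleftrightarrow> i = j" "\<tau> i = \<tau> j \<longleftrightarrow> i = j" for i j
    using permutes_inj[OF \<sigma>] permutes_inj[OF \<tau>] by (auto dest: injD)
  have le: "\<sigma> j \<le> \<sigma> i \<longleftrightarrow> \<tau> j \<le> \<tau> i" if "i \<in> {1..m}" "j \<in> {1..m}" for i j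
  proof (cases i j rule: linorder_cases)
    case less
    then show ?thesis using assms(3)[of i j] that by (auto simp flip: not_less)
  next
    case greater
    then show ?thesis using assms(3)[of j i] that inj[of j i] by (simp add: le_less)
  qed simp
  fix i
  show "\<sigma> i = \<tau> i"
  proof (cases "i \<in> {1..m}")
    case True
    then have "{j \<in> {1..m}. \<sigma> j \<le> \<sigma> i} = {j \<in> {1..m}. \<tau> j \<le> \<tau> i}"
      using le by blast
    then show ?thesis
      using permutes_value_eq_card[OF \<sigma> True] permutes_value_eq_card[OF \<tau> True] by simp
  next
    case False
    then show ?thesis
      using permutes_not_in[OF \<sigma>] permutes_not_in[OF \<tau>] by simp
  qed
qed

lemma perms_l_permutes: "\<sigma> \<in> perms_l m l \<Longrightarrow> \<sigma> permutes {1..m}"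
  by (simp add: perms_l_def)

lemma perms_l_decreasing:
  assumes "\<sigma> \<in> perms_l m l" "1 \<le> i" "i < j" "j \<le> l"
  shows "\<sigma> j < \<sigma> i"
  using assms(3,4)
proof (induction j rule: less_induct)
  case (less j)
  then obtain j' where j: "j = Suc j'" "i \<le> j'"
    by (cases j) auto
  then have step: "\<sigma> j < \<sigma> j'"
    using assms(1,2) less.prems by (auto simp: perms_l_def)
  show ?case
  proof (cases "i = j'")
    case False
    then show ?thesis using less.IH[of j'] less.prems j step by simp
  qed (use step in simp)
qed

lemma finite_perms_l [simp]: "finite (perms_l m l)"
  by (rule finite_subset[OF _ finite_permutations[of "{1..m}"]]) (auto simp: perms_l_def)

lemma des_l_le: "des_l m l \<sigma> \<le> m - 1"
proof -
  have "des_l m l \<sigma> \<le> card {1..m - 1}"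
    unfolding des_l_def by (rule card_mono) auto
  then show ?thesis by simp
qed

text \<open>
  Having no descent means that the decreasing initial block lies below \<open>\<sigma> (l + 1)\<close> and that the
  values increase from there on, so the order of any two values is forced.
\<close>

lemma des_l_zero_order:
  assumes \<sigma>: "\<sigma> \<in> perms_l m l" and "l < m" and des: "des_l m l \<sigma> = 0"
    and "1 \<le> i" "i < j" "j \<le> m"
  shows "\<sigma> i < \<sigma> j \<longleftrightarrow> l < j"
proof -
  have inj: "\<sigma> a = \<sigma> b \<longleftrightarrow> a = b" for a b
    using permutes_inj[OF perms_l_permutes[OF \<sigma>]] by (auto dest: injD)
  have none: "{a \<in> {1..m - 1}. (a \<in> {1..l} \<and> \<sigma> a > \<sigma> (l + 1)) \<or> (a \<notin> {1..l} \<and> \<sigma> a > \<sigma> (a + 1))} = {}"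
    using des by (simp add: des_l_def)
  have low: "\<sigma> a < \<sigma> (l + 1)" if "1 \<le> a" "a \<le> l" for a
  proof -
    have "\<not> \<sigma> a > \<sigma> (l + 1)" using none that \<open>l < m\<close> by auto
    then show ?thesis using inj[of a "l + 1"] that by linarith
  qed
  have up: "\<sigma> a < \<sigma> (a + 1)" if "l < a" "a < m" for a
  proof -
    have "a \<in> {1..m - 1}" "a \<notin> {1..l}" using that by auto
    then have "\<not> \<sigma> a > \<sigma> (a + 1)" using none by blast
    then show ?thesis using inj[of a "a + 1"] by linarith
  qed
  have incr: "\<sigma> a \<le> \<sigma> b" if "l < a" "a \<le> b" "b \<le> m" for a b
    using that(2,3)
  proof (induction b rule: dec_induct)
    case (step b)
    then show ?case using \<open>l < a\<close> up[of b] by simp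
  qed simp
  show ?thesis
  proof (cases "l < j")
    case True
    have "\<sigma> i < \<sigma> j"
    proof (cases "i \<le> l")
      case True
      then show ?thesis
        using low[of i] incr[of "l + 1" j] \<open>l < j\<close> assms(4,6) by simp
    next
      case False
      then show ?thesis
        using incr[of i j] inj[of i j] assms(5,6) by simp
    qed
    then show ?thesis using True by simp
  next
    case False
    then show ?thesis using perms_l_decreasing[OF \<sigma>, of i j] assms(4,5) by simp
  qed
qed

text \<open>
  If every position counts as a descent, then the initial block, which decreases anyway, lies above
  \<open>\<sigma> (l + 1)\<close>, and the values keep falling after it.
\<close>

lemma des_l_top_order:
  assumes \<sigma>: "\<sigma> \<in> perms_l m l" and "l < m" and des: "des_l m l \<sigma> = m - 1"
    and "1 \<le> i" "i < j" "j \<le> m"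
  shows "\<sigma> j < \<sigma> i"
proof -
  have all: "{a \<in> {1..m - 1}. (a \<in> {1..l} \<and> \<sigma> a > \<sigma> (l + 1)) \<or> (a \<notin> {1..l} \<and> \<sigma> a > \<sigma> (a + 1))} = {1..m - 1}"
    using des by (intro card_subset_eq) (auto simp: des_l_def)
  have down: "\<sigma> (a + 1) < \<sigma> a" if "1 \<le> a" "a < m" for a
  proof (cases "a < l")
    case True
    then show ?thesis using perms_l_decreasing[OF \<sigma>, of a "a + 1"] that by simp
  next
    case False
    have "a \<in> {1..m - 1}" using that by simp
    then have "(a \<in> {1..l} \<and> \<sigma> a > \<sigma> (l + 1)) \<or> (a \<notin> {1..l} \<and> \<sigma> a > \<sigma> (a + 1))"
      using all by blast
    moreover have "a \<in> {1..l} \<Longrightarrow> a = l"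
      using False by simp
    ultimately show ?thesis by blast
  qed
  have "\<sigma> b < \<sigma> i" if "Suc i \<le> b" "b \<le> m" for b
    using that
  proof (induction b rule: dec_induct)
    case base
    then show ?case using down[of i] assms(4) by simp
  next
    case (step b)
    then show ?case using assms(4) down[of b] by simp
  qed
  then show ?thesis using assms(5,6) by simp
qed

section \<open>Extending a permutation by a last value\<close>

text \<open>
  In one-line notation: the values that are at least \<open>k\<close> are raised by one to make room, and \<open>k\<close>
  is written at the new position \<open>n + 1\<close>. The relative order of the old values is kept.
\<close>

definition append_value :: "nat \<Rightarrow> nat \<Rightarrow> (nat \<Rightarrow> nat) \<Rightarrow> nat \<Rightarrow> nat" where
  "append_value n k \<tau> i =
     (if i \<in> {1..n} then (if \<tau> i < k then \<tau> i else \<tau> i + 1) else if i = n + 1 then k else i)"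

lemma append_value_permutes:
  assumes \<tau>: "\<tau> permutes {1..n}" and k: "k \<in> {1..n + 1}"
  shows "append_value n k \<tau> permutes {1..n + 1}"
proof (rule bij_imp_permutes)
  have inj: "\<tau> a = \<tau> b \<longleftrightarrow> a = b" for a b
    using permutes_inj[OF \<tau>] by (auto dest: injD)
  have range: "1 \<le> \<tau> a \<and> \<tau> a \<le> n" if "1 \<le> a" "a \<le> n" for a
    using permutes_in_image[OF \<tau>, of a] that by simp
  have *: "inj_on (append_value n k \<tau>) {1..n + 1}"
  proof (rule inj_onI)
    fix x y assume "x \<in> {1..n + 1}" "y \<in> {1..n + 1}" "append_value n k \<tau> x = append_value n k \<tau> y"
    then show "x = y"
      using inj[of x y] by (auto simp: append_value_def split: if_splits)
  qed
  moreover have "append_value n k \<tau> ` {1..n + 1} \<subseteq> {1..n + 1}"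
    using k range by (auto simp: append_value_def le_SucI)
  ultimately show "bij_betw (append_value n k \<tau>) {1..n + 1} {1..n + 1}"
    using endo_inj_surj[of "{1..n + 1}"] unfolding bij_betw_def by blast
qed (auto simp: append_value_def)

lemma append_value_less_iff:
  assumes "a \<in> {1..n}" "b \<in> {1..n}"
  shows "append_value n k \<tau> a < append_value n k \<tau> b \<longleftrightarrow> \<tau> a < \<tau> b"
  using assms by (auto simp: append_value_def)

lemma append_value_last [simp]: "append_value n k \<tau> (Suc n) = k"
  by (simp add: append_value_def)

lemma append_value_greater_last_iff:
  assumes "a \<in> {1..n}"
  shows "k < append_value n k \<tau> a \<longleftrightarrow> k \<le> \<tau> a"
  using assms by (auto simp: append_value_def)

lemma append_value_perms_l:
  assumes "\<tau> \<in> perms_l n l" "l \<le> n" "k \<in> {1..n + 1}"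
  shows "append_value n k \<tau> \<in> perms_l (n + 1) l"
  using assms append_value_permutes[of \<tau> n k] append_value_less_iff[of _ n _ k \<tau>]
  by (auto simp: perms_l_def)

text \<open>
  Order preservation keeps all old descents, and the only new candidate is the position \<open>n\<close>.
  This is the recursion behind all the positivity statements on \<open>A_number\<close>.
\<close>

lemma des_l_append_value:
  assumes "l < n"
  shows "des_l (n + 1) l (append_value n k \<tau>) = des_l n l \<tau> + (if k \<le> \<tau> n then 1 else 0)"
proof -
  let ?D = "\<lambda>\<sigma> i. (i \<in> {1..l} \<and> \<sigma> i > \<sigma> (l + 1)) \<or> (i \<notin> {1..l} \<and> \<sigma> i > \<sigma> (i + 1 :: nat))"
  let ?\<sigma> = "append_value n k \<tau>"
  have same: "?D ?\<sigma> i \<longleftrightarrow> ?D \<tau> i" if "i \<in> {1..n - 1}" for i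
  proof -
    have "i \<in> {1..n}" "i + 1 \<in> {1..n}" "l + 1 \<in> {1..n}"
      using that assms by auto
    then show ?thesis
      by (simp only: append_value_less_iff)
  qed
  have last: "?D ?\<sigma> n \<longleftrightarrow> k \<le> \<tau> n"
    using assms append_value_greater_last_iff[of n n k \<tau>] by simp
  have "{1..n + 1 - 1} = insert n {1..n - 1}"
    using assms by auto
  then have "{i \<in> {1..n + 1 - 1}. ?D ?\<sigma> i} =
      {i \<in> {1..n - 1}. ?D \<tau> i} \<union> (if k \<le> \<tau> n then {n} else {})"
    using same last by auto
  moreover have "n \<notin> {i \<in> {1..n - 1}. ?D \<tau> i}" using assms by simp
  ultimately show ?thesis by (simp add: des_l_def)
qed

lemma A_number_pos_iff:
  "A_number m i k l > 0 \<longleftrightarrow> (\<exists>\<sigma> \<in> perms_l m l. des_l m l \<sigma> = i \<and> \<sigma> m = k)"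
  by (auto simp: A_number_def card_gt_0_iff)

lemma A_number_append_pos:
  assumes "l < n" "A_number n i k' l > 0" "k \<in> {1..n + 1}"
  shows "A_number (Suc n) (i + (if k \<le> k' then 1 else 0)) k l > 0"
proof -
  obtain \<tau> where \<tau>: "\<tau> \<in> perms_l n l" "des_l n l \<tau> = i" "\<tau> n = k'"
    using assms(2) by (auto simp: A_number_pos_iff)
  show ?thesis
    unfolding A_number_pos_iff
    using append_value_perms_l[OF \<tau>(1) _ assms(3)] des_l_append_value[OF assms(1), of k \<tau>] \<tau> assms(1)
    by (intro bexI[of _ "append_value n k \<tau>"]) auto
qed

text \<open>
  For \<open>m = l + 1\<close> the whole permutation decreases apart from its last value \<open>k\<close>, and the descents
  are the \<open>l + 1 - k\<close> values larger than \<open>k\<close>. It arises by appending \<open>k\<close> to the reversal of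
  \<open>{1..l}\<close>.
\<close>

lemma A_number_base_pos:
  assumes "k \<in> {1..l + 1}"
  shows "A_number (l + 1) (l + 1 - k) k l > 0"
proof -
  define \<rho> where "\<rho> = (\<lambda>i. if i \<in> {1..l} then l + 1 - i else i)"
  have "\<rho> permutes {1..l}"
  proof (rule bij_imp_permutes)
    show "bij_betw \<rho> {1..l} {1..l}"
      by (rule bij_betw_byWitness[where f' = \<rho>]) (auto simp: \<rho>_def)
    show "\<rho> x = x" if "x \<notin> {1..l}" for x
      using that unfolding \<rho>_def by (rule if_not_P)
  qed
  then have \<rho>: "\<rho> \<in> perms_l l l"
    by (auto simp: perms_l_def \<rho>_def)
  have "{i \<in> {1..l}. k \<le> \<rho> i} = {1..l + 1 - k}"
    using assms by (auto simp: \<rho>_def)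
  moreover have "{i \<in> {1..l + 1 - 1}. (i \<in> {1..l} \<and> append_value l k \<rho> i > append_value l k \<rho> (l + 1)) \<or>
      (i \<notin> {1..l} \<and> append_value l k \<rho> i > append_value l k \<rho> (i + 1))} = {i \<in> {1..l}. k \<le> \<rho> i}"
    using append_value_greater_last_iff[of _ l k \<rho>] by auto
  ultimately have "des_l (l + 1) l (append_value l k \<rho>) = l + 1 - k"
    by (simp add: des_l_def)
  then show ?thesis
    unfolding A_number_pos_iff
    using append_value_perms_l[OF \<rho> _ assms] by (intro bexI[of _ "append_value l k \<rho>"]) auto
qed

lemma A_number_zero_pos:
  assumes "Suc l \<le> m" shows "A_number m 0 m l > 0"
  using assms
proof (induction m rule: dec_induct)
  case base
  then show ?case using A_number_base_pos[of "l + 1" l] by simp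
next
  case (step n)
  then show ?case using A_number_append_pos[of l n 0 n "Suc n"] by simp
qed

lemma A_number_top_pos:
  assumes "Suc l \<le> m" shows "A_number m (m - 1) 1 l > 0"
  using assms
proof (induction m rule: dec_induct)
  case base
  then show ?case using A_number_base_pos[of 1 l] by simp
next
  case (step n)
  then show ?case using A_number_append_pos[of l n "n - 1" 1 1] by simp
qed

text \<open>
  Induction on \<open>m\<close> along the recursion given by appending a last value \<open>k\<close> to a shorter permutation
  ending in \<open>k'\<close>, which adds a descent exactly if \<open>k \<le> k'\<close>. Usually \<open>k' = 2\<close> works:
  it adds no descent if \<open>3 \<le> k\<close> and one if \<open>k = 2\<close>. Where this leaves the range of the
  induction hypothesis, at \<open>i = m - 2\<close> and at \<open>i = 1\<close>, \<open>k = 2\<close>, the permutation with all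
  descents, ending in \<open>1\<close>, and the one without descents serve instead.
\<close>

lemma A_number_interior_pos:
  assumes "Suc (Suc l) \<le> m" "1 \<le> l" "1 \<le> i" "i \<le> m - 2" "2 \<le> k" "k \<le> m - 1"
  shows "A_number m i k l > 0"
  using assms(1,3-)
proof (induction m arbitrary: i k rule: dec_induct)
  case base
  show ?case
  proof (cases "i \<le> l + 2 - k")
    case True
    \<comment> \<open>Appending \<open>k\<close> adds a descent here, so the shorter permutation must have \<open>i - 1\<close> of them,
      which forces its last value to be \<open>l + 2 - i\<close>.\<close>
    then have "k \<le> l + 2 - i" "l + 1 - (l + 2 - i) = i - 1"
      using base by simp_all
    then show ?thesis
      using A_number_append_pos[of l "l + 1" "i - 1" "l + 2 - i" k] A_number_base_pos[of "l + 2 - i" l] base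
      by simp
  next
    case False
    then have "\<not> k \<le> l + 1 - i" "l + 1 - (l + 1 - i) = i"
      using base by simp_all
    then show ?thesis
      using A_number_append_pos[of l "l + 1" "i" "l + 1 - i" k] A_number_base_pos[of "l + 1 - i" l] base
      by simp
  qed
next
  case (step n)
  have l: "l < n" using step.hyps by simp
  consider "i = n - 1" | "i \<le> n - 2" "3 \<le> k" | "i \<le> n - 2" "k = 2" "i = 1" | "i \<le> n - 2" "k = 2" "2 \<le> i"
    using step.prems by linarith
  then show ?case
  proof cases
    case 1
    then show ?thesis
      using A_number_append_pos[OF l A_number_top_pos, of k] l step.prems by simp
  next
    case 2
    then show ?thesis
      using A_number_append_pos[OF l step.IH[of i 2], of k] step.hyps step.prems assms(2) by simp
  next
    case 3
    then show ?thesis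
      using A_number_append_pos[OF l A_number_zero_pos, of k] l step.prems by simp
  next
    case 4
    then show ?thesis
      using A_number_append_pos[OF l step.IH[of "i - 1" 2], of k] step.hyps step.prems assms(2) by simp
  qed
qed

section \<open>Extreme descent numbers and sums over all descent numbers\<close>

lemma A_number_zero:
  assumes "l < m"
  shows "A_number m 0 k l = (if k = m then 1 else 0)"
proof -
  obtain \<sigma> where \<sigma>: "\<sigma> \<in> perms_l m l" "des_l m l \<sigma> = 0" "\<sigma> m = m"
    using A_number_zero_pos[of l m] assms by (auto simp: A_number_pos_iff)
  have "\<tau> = \<sigma>" if \<tau>: "\<tau> \<in> perms_l m l" "des_l m l \<tau> = 0" for \<tau>
  proof (rule permutes_eqI_order[OF perms_l_permutes[OF \<tau>(1)] perms_l_permutes[OF \<sigma>(1)]])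
    fix i j assume "1 \<le> i" "i < j" "j \<le> m"
    then show "\<tau> i < \<tau> j \<longleftrightarrow> \<sigma> i < \<sigma> j"
      using des_l_zero_order[OF \<tau>(1) assms \<tau>(2), of i j] des_l_zero_order[OF \<sigma>(1) assms \<sigma>(2), of i j]
      by simp
  qed
  then have only: "{\<tau> \<in> perms_l m l. des_l m l \<tau> = 0} = {\<sigma>}"
    using \<sigma> by blast
  have "{\<tau> \<in> perms_l m l. des_l m l \<tau> = 0 \<and> \<tau> m = k} =
      {\<tau> \<in> {\<tau> \<in> perms_l m l. des_l m l \<tau> = 0}. \<tau> m = k}"
    by blast
  also have "\<dots> = {\<tau> \<in> {\<sigma>}. \<tau> m = k}"
    unfolding only ..
  also have "\<dots> = (if k = m then {\<sigma>} else {})"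
    using \<sigma>(3) by auto
  finally show ?thesis by (simp add: A_number_def)
qed

lemma A_number_top:
  assumes "l < m"
  shows "A_number m (m - 1) k l = (if k = 1 then 1 else 0)"
proof -
  obtain \<sigma> where \<sigma>: "\<sigma> \<in> perms_l m l" "des_l m l \<sigma> = m - 1" "\<sigma> m = 1"
    using A_number_top_pos[of l m] assms by (auto simp: A_number_pos_iff)
  have "\<tau> = \<sigma>" if \<tau>: "\<tau> \<in> perms_l m l" "des_l m l \<tau> = m - 1" for \<tau>
  proof (rule permutes_eqI_order[OF perms_l_permutes[OF \<tau>(1)] perms_l_permutes[OF \<sigma>(1)]])
    fix i j assume "1 \<le> i" "i < j" "j \<le> m"
    then show "\<tau> i < \<tau> j \<longleftrightarrow> \<sigma> i < \<sigma> j"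
      using des_l_top_order[OF \<tau>(1) assms \<tau>(2), of i j] des_l_top_order[OF \<sigma>(1) assms \<sigma>(2), of i j]
      by simp
  qed
  then have only: "{\<tau> \<in> perms_l m l. des_l m l \<tau> = m - 1} = {\<sigma>}"
    using \<sigma> by blast
  have "{\<tau> \<in> perms_l m l. des_l m l \<tau> = m - 1 \<and> \<tau> m = k} =
      {\<tau> \<in> {\<tau> \<in> perms_l m l. des_l m l \<tau> = m - 1}. \<tau> m = k}"
    by blast
  also have "\<dots> = {\<tau> \<in> {\<sigma>}. \<tau> m = k}"
    unfolding only ..
  also have "\<dots> = (if k = 1 then {\<sigma>} else {})"
    using \<sigma>(3) by auto
  finally show ?thesis by (simp add: A_number_def)
qed

lemma sum_A_number:
  assumes "0 < m"
  shows "(\<Sum>i<m. A_number m i k l) = card {\<sigma> \<in> perms_l m l. \<sigma> m = k}"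
proof -
  have "des_l m l \<sigma> < m" for \<sigma>
    using des_l_le[of m l \<sigma>] assms by linarith
  then have "{\<sigma> \<in> perms_l m l. \<sigma> m = k} = (\<Union>i\<in>{..<m}. {\<sigma> \<in> perms_l m l. des_l m l \<sigma> = i \<and> \<sigma> m = k})"
    by blast
  then have "card {\<sigma> \<in> perms_l m l. \<sigma> m = k} =
      card (\<Union>i\<in>{..<m}. {\<sigma> \<in> perms_l m l. des_l m l \<sigma> = i \<and> \<sigma> m = k})"
    by (rule arg_cong)
  also have "\<dots> = (\<Sum>i<m. A_number m i k l)"
    unfolding A_number_def by (rule card_UN_disjoint) auto
  finally show ?thesis by (rule sym)
qed

text \<open>
  Exchanging the values \<open>k\<close> and \<open>k + 1\<close> is a bijection. It could only spoil the decrease on the first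
  \<open>l\<close> positions if both values occurred there, but one of them sits at position \<open>m > l\<close>.
\<close>

lemma card_perms_l_last_Suc:
  assumes "l < m" "1 \<le> k" "k < m"
  shows "card {\<sigma> \<in> perms_l m l. \<sigma> m = k} = card {\<sigma> \<in> perms_l m l. \<sigma> m = Suc k}"
proof -
  define T :: "(nat \<Rightarrow> nat) \<Rightarrow> nat \<Rightarrow> nat" where "T \<sigma> = transpose k (Suc k) \<circ> \<sigma>" for \<sigma>
  have T: "T \<sigma> \<in> perms_l m l" if \<sigma>: "\<sigma> \<in> perms_l m l" and last: "\<sigma> m = k \<or> \<sigma> m = Suc k" for \<sigma>
  proof -
    have "T \<sigma> permutes {1..m}"
      unfolding T_def using assms \<sigma> by (intro permutes_compose perms_l_permutes permutes_swap_id) auto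
    moreover have "T \<sigma> (i + 1) < T \<sigma> i" if i: "i \<in> {1..<l}" for i
    proof -
      have "i \<noteq> m" "i + 1 \<noteq> m"
        using i assms(1) by auto
      then have "\<sigma> i \<noteq> \<sigma> m" "\<sigma> (i + 1) \<noteq> \<sigma> m"
        using injD[OF permutes_inj[OF perms_l_permutes[OF \<sigma>]]] by blast+
      moreover have "\<sigma> (i + 1) < \<sigma> i"
        using \<sigma> i by (auto simp: perms_l_def)
      ultimately show ?thesis
        using last unfolding T_def o_def transpose_def by (simp split: if_split) arith
    qed
    ultimately show ?thesis by (simp add: perms_l_def)
  qed
  have last: "T \<sigma> m = transpose k (Suc k) (\<sigma> m)" and inv: "T (T \<sigma>) = \<sigma>" for \<sigma>
    by (simp_all add: T_def flip: comp_assoc)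
  have "bij_betw T {\<sigma> \<in> perms_l m l. \<sigma> m = k} {\<sigma> \<in> perms_l m l. \<sigma> m = Suc k}"
    by (rule bij_betw_byWitness[where f' = T]) (use T last inv in auto)
  then show ?thesis by (rule bij_betw_same_card)
qed

text \<open>
  Read as a statement on matrices, this says that all columns of \<open>H_matrix\<close> have the same sum.
\<close>

lemma sum_A_number_indep:
  assumes "l < m" "1 \<le> k" "k \<le> m"
  shows "(\<Sum>i<m. A_number m i k l) = (\<Sum>i<m. A_number m i 1 l)"
  using assms(2,3)
proof (induction k rule: dec_induct)
  case (step k)
  then show ?case using assms(1) card_perms_l_last_Suc[of l m k] by (simp add: sum_A_number)
qed simp

section \<open>Nonnegative matrices with constant column sums\<close>

lemma mult_mat_vec_index_sum:
  fixes A :: "'a::comm_ring_1 mat"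
  assumes "A \<in> carrier_mat n n" "x \<in> carrier_vec n" "i < n"
  shows "(A *\<^sub>v x) $ i = (\<Sum>j<n. A $$ (i, j) * x $ j)"
  using assms by (auto simp: scalar_prod_def atLeast0LessThan intro!: sum.cong)

lemma eigenvector_index:
  fixes A :: "'a::comm_ring_1 mat"
  assumes "A \<in> carrier_mat n n" "eigenvector A x k" "i < n"
  shows "(\<Sum>j<n. A $$ (i, j) * x $ j) = k * x $ i"
proof -
  have x: "x \<in> carrier_vec n" "A *\<^sub>v x = k \<cdot>\<^sub>v x"
    using assms(1,2) by (auto simp: eigenvector_def)
  show ?thesis
    using mult_mat_vec_index_sum[OF assms(1) x(1) assms(3)] x assms(3) by simp
qed

lemma eigenvectorI_index:
  fixes A :: "'a::comm_ring_1 mat"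
  assumes A: "A \<in> carrier_mat n n" and x: "x \<in> carrier_vec n" "x \<noteq> 0\<^sub>v n"
    and eq: "\<And>i. i < n \<Longrightarrow> (\<Sum>j<n. A $$ (i, j) * x $ j) = k * x $ i"
  shows "eigenvector A x k"
proof -
  have "A *\<^sub>v x = k \<cdot>\<^sub>v x"
  proof (rule eq_vecI)
    fix i assume "i < dim_vec (k \<cdot>\<^sub>v x)"
    then have i: "i < n" using x(1) by simp
    then show "(A *\<^sub>v x) $ i = (k \<cdot>\<^sub>v x) $ i"
      using mult_mat_vec_index_sum[OF A x(1) i] eq[OF i] x(1) by simp
  qed (use A x(1) in auto)
  then show ?thesis
    using A x by (simp add: eigenvector_def)
qed

lemma eigenvector_nonzero_entry:
  assumes "A \<in> carrier_mat n n" "eigenvector A x k"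
  obtains i where "i < n" "x $ i \<noteq> 0"
proof -
  have "x \<in> carrier_vec n" "x \<noteq> 0\<^sub>v n"
    using assms by (auto simp: eigenvector_def)
  then have "\<exists>i<n. x $ i \<noteq> 0"
    by (auto simp: vec_eq_iff)
  then show ?thesis using that by blast
qed

text \<open>
  Constant column sums make the all-ones row vector a left eigenvector: the functional that adds up the
  coordinates is multiplied by \<open>c\<close>. Hence it vanishes on eigenvectors for every other eigenvalue.
\<close>

lemma sum_const_column_sum:
  fixes A :: "'a::comm_ring_1 mat"
  assumes "\<And>j. j < n \<Longrightarrow> (\<Sum>i<n. A $$ (i, j)) = c"
  shows "(\<Sum>i<n. \<Sum>j<n. A $$ (i, j) * y j) = c * (\<Sum>j<n. y j)"
proof -
  have "(\<Sum>i<n. \<Sum>j<n. A $$ (i, j) * y j) = (\<Sum>j<n. (\<Sum>i<n. A $$ (i, j)) * y j)"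
    by (subst sum.swap) (simp add: sum_distrib_right)
  also have "\<dots> = c * (\<Sum>j<n. y j)"
    using assms by (simp add: sum_distrib_left)
  finally show ?thesis .
qed

lemma eigenvector_sum_zero:
  fixes A :: "'a::idom mat"
  assumes A: "A \<in> carrier_mat n n" and col: "\<And>j. j < n \<Longrightarrow> (\<Sum>i<n. A $$ (i, j)) = c"
    and x: "eigenvector A x k" and "k \<noteq> c"
  shows "(\<Sum>i<n. x $ i) = 0"
proof -
  have "k * (\<Sum>i<n. x $ i) = (\<Sum>i<n. \<Sum>j<n. A $$ (i, j) * x $ j)"
    using eigenvector_index[OF A x] by (simp add: sum_distrib_left)
  also have "\<dots> = c * (\<Sum>i<n. x $ i)"
    using col by (rule sum_const_column_sum)
  finally show ?thesis using \<open>k \<noteq> c\<close> by simp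
qed

text \<open>
  Adding the triangle inequalities of all rows of \<open>A x = k x\<close> bounds \<open>\<bar>k\<bar>\<close> times the
  \<open>1\<close>-norm of \<open>x\<close> by \<open>c\<close> times that norm.
\<close>

lemma eigenvalue_abs_le_column_sum:
  fixes A :: "real mat"
  assumes A: "A \<in> carrier_mat n n" and nonneg: "\<And>i j. i < n \<Longrightarrow> j < n \<Longrightarrow> 0 \<le> A $$ (i, j)"
    and col: "\<And>j. j < n \<Longrightarrow> (\<Sum>i<n. A $$ (i, j)) = c"
    and x: "eigenvector A x k"
  shows "\<bar>k\<bar> \<le> c"
proof -
  obtain r where r: "r < n" "x $ r \<noteq> 0"
    using eigenvector_nonzero_entry[OF A x] .
  have pos: "0 < (\<Sum>i<n. \<bar>x $ i\<bar>)"
    by (rule sum_pos2[of _ r]) (use r in auto)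
  have "\<bar>k\<bar> * (\<Sum>i<n. \<bar>x $ i\<bar>) = (\<Sum>i<n. \<bar>\<Sum>j<n. A $$ (i, j) * x $ j\<bar>)"
    using eigenvector_index[OF A x] by (simp add: sum_distrib_left abs_mult)
  also have "\<dots> \<le> (\<Sum>i<n. \<Sum>j<n. A $$ (i, j) * \<bar>x $ j\<bar>)"
    by (intro sum_mono order.trans[OF sum_abs]) (simp add: abs_mult nonneg)
  also have "\<dots> = c * (\<Sum>i<n. \<bar>x $ i\<bar>)"
    using col by (rule sum_const_column_sum)
  finally show ?thesis using pos by simp
qed

text \<open>
  The equality case of the previous estimate, as in the Perron-Frobenius theorem: if two entries of
  opposite sign meet in one row with positive weights, then the triangle inequality is strict in that
  row, so that \<open>c\<close> times the \<open>1\<close>-norm of \<open>x\<close> would be smaller than itself.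
\<close>

lemma perron_eigenvector_no_sign_change:
  fixes A :: "real mat"
  assumes A: "A \<in> carrier_mat n n" and nonneg: "\<And>i j. i < n \<Longrightarrow> j < n \<Longrightarrow> 0 \<le> A $$ (i, j)"
    and col: "\<And>j. j < n \<Longrightarrow> (\<Sum>i<n. A $$ (i, j)) = c"
    and x: "eigenvector A x c"
    and ab: "a < n" "b < n" "0 < x $ a" "x $ b < 0"
    and r: "r < n" "0 < A $$ (r, a)" "0 < A $$ (r, b)"
  shows False
proof -
  have "0 \<le> c"
    using eigenvalue_abs_le_column_sum[OF A nonneg col x] by linarith
  have le: "\<bar>\<Sum>j<n. A $$ (i, j) * x $ j\<bar> \<le> (\<Sum>j<n. A $$ (i, j) * \<bar>x $ j\<bar>)" if "i < n" for i
    by (rule order.trans[OF sum_abs]) (use that in \<open>simp add: abs_mult nonneg\<close>)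
  have upper: "(\<Sum>j<n. A $$ (r, j) * x $ j) < (\<Sum>j<n. A $$ (r, j) * \<bar>x $ j\<bar>)"
  proof (rule sum_strict_mono_ex1)
    show "\<forall>j\<in>{..<n}. A $$ (r, j) * x $ j \<le> A $$ (r, j) * \<bar>x $ j\<bar>"
      using nonneg r(1) by (simp add: mult_left_mono)
    show "\<exists>j\<in>{..<n}. A $$ (r, j) * x $ j < A $$ (r, j) * \<bar>x $ j\<bar>"
      using ab r mult_pos_neg[of "A $$ (r, b)" "x $ b"] by (intro bexI[of _ b]) auto
  qed simp
  have lower: "(\<Sum>j<n. - (A $$ (r, j) * x $ j)) < (\<Sum>j<n. A $$ (r, j) * \<bar>x $ j\<bar>)"
  proof (rule sum_strict_mono_ex1)
    show "\<forall>j\<in>{..<n}. - (A $$ (r, j) * x $ j) \<le> A $$ (r, j) * \<bar>x $ j\<bar>"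
    proof
      fix j assume "j \<in> {..<n}"
      then have "A $$ (r, j) * (- x $ j) \<le> A $$ (r, j) * \<bar>x $ j\<bar>"
        using nonneg r(1) by (intro mult_left_mono) auto
      then show "- (A $$ (r, j) * x $ j) \<le> A $$ (r, j) * \<bar>x $ j\<bar>" by simp
    qed
    show "\<exists>j\<in>{..<n}. - (A $$ (r, j) * x $ j) < A $$ (r, j) * \<bar>x $ j\<bar>"
      using ab r mult_pos_pos[of "A $$ (r, a)" "x $ a"] by (intro bexI[of _ a]) auto
  qed simp
  have "\<bar>\<Sum>j<n. A $$ (r, j) * x $ j\<bar> < (\<Sum>j<n. A $$ (r, j) * \<bar>x $ j\<bar>)"
    using upper lower by (simp add: sum_negf abs_less_iff)
  then have "(\<Sum>i<n. \<bar>\<Sum>j<n. A $$ (i, j) * x $ j\<bar>) < (\<Sum>i<n. \<Sum>j<n. A $$ (i, j) * \<bar>x $ j\<bar>)"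
    using le r(1) by (intro sum_strict_mono_ex1) auto
  also have "\<dots> = c * (\<Sum>i<n. \<bar>x $ i\<bar>)"
    using col by (rule sum_const_column_sum)
  also have "\<dots> = (\<Sum>i<n. \<bar>\<Sum>j<n. A $$ (i, j) * x $ j\<bar>)"
    using eigenvector_index[OF A x] \<open>0 \<le> c\<close> by (simp add: sum_distrib_left abs_mult)
  finally show False by simp
qed

text \<open>
  The all-ones vector lies in the kernel of the transpose of \<open>A - c I\<close>. So the determinant vanishes and
  \<open>A - c I\<close> has a kernel as well. The lemma holds over every field, so that it can be applied over
  the rationals.
\<close>

lemma column_sum_eigenvector_exists:
  fixes A :: "'a::field mat"
  assumes A: "A \<in> carrier_mat n n" and "0 < n"
    and col: "\<And>j. j < n \<Longrightarrow> (\<Sum>i<n. A $$ (i, j)) = c"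
  shows "\<exists>x. eigenvector A x c"
proof -
  define B where "B = A - c \<cdot>\<^sub>m 1\<^sub>m n"
  have B: "B \<in> carrier_mat n n"
    unfolding B_def by (rule minus_carrier_mat) simp
  define e :: "'a vec" where "e = vec n (\<lambda>_. 1)"
  have e: "e \<in> carrier_vec n" by (simp add: e_def)
  have "e $ 0 \<noteq> 0\<^sub>v n $ 0" using \<open>0 < n\<close> by (simp add: e_def)
  then have "e \<noteq> 0\<^sub>v n" by metis
  moreover have "transpose_mat B *\<^sub>v e = 0\<^sub>v n"
  proof (rule eq_vecI)
    fix j assume "j < dim_vec (0\<^sub>v n :: 'a vec)"
    then have j: "j < n" by simp
    have "(transpose_mat B *\<^sub>v e) $ j = (\<Sum>i<n. transpose_mat B $$ (j, i) * e $ i)"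
      using B by (intro mult_mat_vec_index_sum[OF _ e j]) simp
    also have "\<dots> = (\<Sum>i<n. A $$ (i, j) - (if i = j then c else 0))"
      using A j by (intro sum.cong) (auto simp: B_def e_def)
    also have "\<dots> = 0"
      using col[OF j] j by (simp add: sum_subtractf)
    finally show "(transpose_mat B *\<^sub>v e) $ j = 0\<^sub>v n $ j" using j by simp
  qed (use B in simp)
  ultimately have "det (transpose_mat B) = 0"
    using e B by (subst det_0_iff_vec_prod_zero_field[of _ n]) auto
  then have "det B = 0"
    using det_transpose[OF B] by simp
  then obtain x where x: "x \<in> carrier_vec n" "x \<noteq> 0\<^sub>v n" "B *\<^sub>v x = 0\<^sub>v n"
    using det_0_iff_vec_prod_zero_field[OF B] by blast
  have "eigenvector A x c"
  proof (rule eigenvectorI_index[OF A x(1,2)])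
    fix i assume i: "i < n"
    have "0 = (\<Sum>j<n. B $$ (i, j) * x $ j)"
      using mult_mat_vec_index_sum[OF B x(1) i] x(3) i by simp
    also have "\<dots> = (\<Sum>j<n. A $$ (i, j) * x $ j - (if j = i then c * x $ j else 0))"
      using A i by (intro sum.cong) (auto simp: B_def algebra_simps)
    also have "\<dots> = (\<Sum>j<n. A $$ (i, j) * x $ j) - c * x $ i"
      using i by (simp add: sum_subtractf)
    finally show "(\<Sum>j<n. A $$ (i, j) * x $ j) = c * x $ i" by simp
  qed
  then show ?thesis ..
qed

text \<open>
  A matrix of natural numbers can be read over the rationals. An eigenvector found there stays one over
  the reals.
\<close>

lemma column_sum_rational_eigenvector_exists:
  fixes A :: "real mat" and N :: "nat \<Rightarrow> nat \<Rightarrow> nat"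
  assumes A: "A \<in> carrier_mat n n" and "0 < n"
    and N: "\<And>i j. i < n \<Longrightarrow> j < n \<Longrightarrow> A $$ (i, j) = real (N i j)"
    and col: "\<And>j. j < n \<Longrightarrow> (\<Sum>i<n. A $$ (i, j)) = real c"
  shows "\<exists>x. eigenvector A x (real c) \<and> (\<forall>i<n. x $ i \<in> \<rat>)"
proof -
  define B :: "rat mat" where "B = mat n n (\<lambda>(i, j). of_nat (N i j))"
  have B: "B \<in> carrier_mat n n" by (simp add: B_def)
  have "(\<Sum>i<n. B $$ (i, j)) = of_nat c" if j: "j < n" for j
  proof -
    have "real (\<Sum>i<n. N i j) = real c"
      using col[OF j] N j by simp
    then have "(\<Sum>i<n. N i j) = c" by (simp only: of_nat_eq_iff)
    then show ?thesis using j by (simp add: B_def flip: of_nat_sum)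
  qed
  then obtain q where q: "eigenvector B q (of_nat c)"
    using column_sum_eigenvector_exists[OF B \<open>0 < n\<close>] by blast
  define x :: "real vec" where "x = vec n (\<lambda>i. of_rat (q $ i))"
  obtain r where "r < n" "q $ r \<noteq> 0"
    using eigenvector_nonzero_entry[OF B q] .
  then have "x $ r \<noteq> 0\<^sub>v n $ r" by (simp add: x_def)
  then have "x \<noteq> 0\<^sub>v n" by metis
  moreover have "(\<Sum>j<n. A $$ (i, j) * x $ j) = real c * x $ i" if i: "i < n" for i
  proof -
    have "(\<Sum>j<n. A $$ (i, j) * x $ j) = of_rat (\<Sum>j<n. B $$ (i, j) * q $ j)"
      using i N by (simp add: B_def x_def of_rat_sum of_rat_mult)
    also have "\<dots> = real c * x $ i"
      using i eigenvector_index[OF B q i] by (simp add: x_def of_rat_mult)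
    finally show ?thesis .
  qed
  ultimately have "eigenvector A x (real c)"
    by (intro eigenvectorI_index[OF A]) (auto simp: x_def)
  then show ?thesis by (intro exI[of _ x]) (auto simp: x_def)
qed

section \<open>The transformation matrix of the h-vector\<close>

lemma H_matrix_carrier: "H_matrix d l \<in> carrier_mat (d + 1) (d + 1)"
  by (simp add: H_matrix_def)

lemma H_matrix_index:
  "i < d + 1 \<Longrightarrow> j < d + 1 \<Longrightarrow> H_matrix d l $$ (i, j) = real (A_number (d + 1) i (d + 1 - j) l)"
  by (simp add: H_matrix_def)

lemma H_matrix_nonneg: "i < d + 1 \<Longrightarrow> j < d + 1 \<Longrightarrow> 0 \<le> H_matrix d l $$ (i, j)"
  by (simp add: H_matrix_index)

text \<open>
  Together with the first and last row, which are unit vectors, this describes the shape of the matrix: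
  apart from the two outer coordinates it acts by a strictly positive block.
\<close>

lemma H_matrix_interior_pos:
  assumes "1 \<le> l" "l \<le> d - 1" "i \<in> {1..d - 1}" "j \<in> {1..d - 1}"
  shows "0 < H_matrix d l $$ (i, j)"
proof -
  have "A_number (d + 1) i (d + 1 - j) l > 0"
    using assms by (intro A_number_interior_pos) auto
  then show ?thesis using assms by (subst H_matrix_index) auto
qed

lemma H_matrix_first_row:
  assumes "l \<le> d" "j < d + 1"
  shows "H_matrix d l $$ (0, j) = (if j = 0 then 1 else 0)"
  using assms by (subst H_matrix_index) (auto simp: A_number_zero)

lemma H_matrix_last_row:
  assumes "l \<le> d" "j < d + 1"
  shows "H_matrix d l $$ (d, j) = (if j = d then 1 else 0)"
  using assms A_number_top[of l "d + 1" "d + 1 - j"] by (subst H_matrix_index) auto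

definition column_sum :: "nat \<Rightarrow> nat \<Rightarrow> nat" where
  "column_sum d l = (\<Sum>i<d + 1. A_number (d + 1) i 1 l)"

lemma H_matrix_column_sum:
  assumes "l \<le> d" "j < d + 1"
  shows "(\<Sum>i<d + 1. H_matrix d l $$ (i, j)) = real (column_sum d l)"
proof -
  have "(\<Sum>i<d + 1. H_matrix d l $$ (i, j)) = real (\<Sum>i<d + 1. A_number (d + 1) i (d + 1 - j) l)"
    unfolding of_nat_sum using assms(2) by (intro sum.cong refl H_matrix_index) auto
  also have "(\<Sum>i<d + 1. A_number (d + 1) i (d + 1 - j) l) = column_sum d l"
    unfolding column_sum_def using assms by (intro sum_A_number_indep) auto
  finally show ?thesis .
qed

text \<open>
  The first and last row of the matrix are unit vectors, so the outer coordinates of \<open>x\<close> are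
  preserved and also multiplied by \<open>k\<close>.
\<close>

lemma eigenvector_ends_zero:
  assumes "l \<le> d" "eigenvector (H_matrix d l) x k" "k \<noteq> 1"
  shows "x $ 0 = 0" "x $ d = 0"
proof -
  have "k * x $ 0 = (\<Sum>j<d + 1. H_matrix d l $$ (0, j) * x $ j)"
    by (rule eigenvector_index[OF H_matrix_carrier assms(2), symmetric]) simp
  also have "\<dots> = (\<Sum>j<d + 1. if j = 0 then x $ j else 0)"
    using assms(1) by (intro sum.cong) (auto simp: H_matrix_first_row)
  also have "\<dots> = x $ 0" by (simp del: sum.lessThan_Suc)
  finally show "x $ 0 = 0" using assms(3) by simp
  have "k * x $ d = (\<Sum>j<d + 1. H_matrix d l $$ (d, j) * x $ j)"
    by (rule eigenvector_index[OF H_matrix_carrier assms(2), symmetric]) simp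
  also have "\<dots> = (\<Sum>j<d + 1. if j = d then x $ j else 0)"
    using assms(1) by (intro sum.cong) (auto simp: H_matrix_last_row)
  also have "\<dots> = x $ d" by (simp del: sum.lessThan_Suc)
  finally show "x $ d = 0" using assms(3) by simp
qed

text \<open>
  A rational eigenvector \<open>x\<close> exists because the common column sum is a natural number. Its outer
  coordinates vanish, and the positive inner block excludes a sign change. So \<open>x\<close> or \<open>- x\<close> is
  nonnegative, and one more application of the positive block makes every inner coordinate positive.
\<close>

lemma positive_rational_eigenvector_exists:
  assumes l: "1 \<le> l" "l \<le> d - 1" and c: "column_sum d l \<noteq> 1"
  obtains u where "eigenvector (H_matrix d l) u (real (column_sum d l))"
    "\<And>i. i \<in> {1..d - 1} \<Longrightarrow> u $ i \<in> \<rat> \<and> 0 < u $ i"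
proof -
  let ?H = "H_matrix d l" and ?c = "real (column_sum d l)"
  note H = H_matrix_carrier[of d l]
  have ld: "l \<le> d" using l by simp
  have inner: "i \<in> {1..d - 1}" if "i < d + 1" "i \<noteq> 0" "i \<noteq> d" for i
    using that by auto
  obtain x where x: "eigenvector ?H x ?c" and rat: "\<forall>i<d + 1. x $ i \<in> \<rat>"
    using column_sum_rational_eigenvector_exists[OF H _ H_matrix_index H_matrix_column_sum[OF ld]] by auto
  have x_carrier: "x \<in> carrier_vec (d + 1)"
    using x H by (auto simp: eigenvector_def)
  have ends: "x $ 0 = 0" "x $ d = 0"
    using eigenvector_ends_zero[OF ld x] c by auto
  have no_change: "\<not> (0 < x $ a \<and> x $ b < 0)" if ab: "a < d + 1" "b < d + 1" for a b
  proof
    assume *: "0 < x $ a \<and> x $ b < 0"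
    then have "a \<in> {1..d - 1}" "b \<in> {1..d - 1}"
      using ab ends by (metis inner less_irrefl)+
    then show False
      using perron_eigenvector_no_sign_change[OF H H_matrix_nonneg H_matrix_column_sum[OF ld] x ab]
        * H_matrix_interior_pos[OF l] ab by blast
  qed
  \<comment> \<open>the sign that makes the eigenvector nonnegative\<close>
  obtain s :: real where s: "s \<in> {1, -1}" "\<And>i. i < d + 1 \<Longrightarrow> 0 \<le> s * x $ i"
  proof (cases "\<exists>a<d + 1. 0 < x $ a")
    case True
    then have "0 \<le> 1 * x $ i" if "i < d + 1" for i
      using no_change that by force
    then show ?thesis using that[of 1] by blast
  next
    case False
    then have "0 \<le> - 1 * x $ i" if "i < d + 1" for i
      using that by force
    then show ?thesis using that[of "- 1"] by blast
  qed
  define u where "u = s \<cdot>\<^sub>v x"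
  have u_index: "u $ i = s * x $ i" if "i < d + 1" for i
    using that x_carrier by (simp add: u_def)
  have "s \<noteq> 0" using s(1) by auto
  obtain r where r: "r < d + 1" "x $ r \<noteq> 0"
    using eigenvector_nonzero_entry[OF H x] .
  have "u $ r \<noteq> 0\<^sub>v (d + 1) $ r"
    using r \<open>s \<noteq> 0\<close> by (simp add: u_index)
  then have "u \<noteq> 0\<^sub>v (d + 1)" by metis
  have u: "eigenvector ?H u ?c"
  proof (rule eigenvectorI_index[OF H])
    fix i assume i: "i < d + 1"
    have "(\<Sum>j<d + 1. ?H $$ (i, j) * u $ j) = s * (\<Sum>j<d + 1. ?H $$ (i, j) * x $ j)"
      unfolding sum_distrib_left by (intro sum.cong) (auto simp: u_index)
    then show "(\<Sum>j<d + 1. ?H $$ (i, j) * u $ j) = ?c * u $ i"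
      using eigenvector_index[OF H x i] i by (simp add: u_index)
  qed (use \<open>u \<noteq> 0\<^sub>v (d + 1)\<close> x_carrier in \<open>simp_all add: u_def\<close>)
  have "r \<noteq> 0" "r \<noteq> d" using r(2) ends by metis+
  then have r_inner: "r \<in> {1..d - 1}" using inner r(1) by blast
  have "0 < u $ r"
    using s(2)[OF r(1)] r \<open>s \<noteq> 0\<close> by (simp add: u_index less_le)
  have "u $ i \<in> \<rat> \<and> 0 < u $ i" if i: "i \<in> {1..d - 1}" for i
  proof
    have i': "i < d + 1" using i by auto
    show "u $ i \<in> \<rat>"
      using rat s(1) i' by (auto simp: u_index)
    have "0 < (\<Sum>j<d + 1. ?H $$ (i, j) * u $ j)"
    proof (rule sum_pos2[of _ r])
      show "0 < ?H $$ (i, r) * u $ r"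
        using H_matrix_interior_pos[OF l i r_inner] \<open>0 < u $ r\<close> by simp
      show "0 \<le> ?H $$ (i, j) * u $ j" if "j \<in> {..<d + 1}" for j
        using that s(2)[of j] H_matrix_nonneg[OF i', of j] by (simp add: u_index)
    qed (use r(1) in auto)
    then show "0 < u $ i"
      using eigenvector_index[OF H u i'] by (simp add: zero_less_mult_iff)
  qed
  then show ?thesis using that u by blast
qed

section \<open>Bases of coordinate space\<close>

lemma (in vec_space) spanning_list_is_basis:
  assumes "set xs \<subseteq> carrier_vec n" "length xs = n" "span (set xs) = carrier_vec n"
  shows "distinct xs" "basis (set xs)"
proof -
  show b: "basis (set xs)"
    using assms card_length[of xs] by (intro dim_gen_is_basis) (auto simp: dim_is_n)
  have "card (set xs) = length xs"
    using dim_basis[OF finite_set b] assms(2) by (simp add: dim_is_n)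
  then show "distinct xs" by (rule card_distinct)
qed

text \<open>
  The Steinitz exchange step: \<open>u\<close>, here written as \<open>lincomb c S\<close>, involves \<open>y\<close> with a nonzero
  coefficient, so \<open>y\<close> can be solved for, and a span that contains \<open>u\<close> and the other elements of
  \<open>S\<close> contains all of \<open>S\<close>.
\<close>

lemma (in vec_space) exchange_spans:
  assumes S: "finite S" "span S = carrier_vec n" "S \<subseteq> carrier_vec n" and T: "T \<subseteq> carrier_vec n"
    and y: "y \<in> S" and rest: "S - {y} \<subseteq> span T"
    and u: "lincomb c S \<in> span T" "c y \<noteq> 0"
  shows "span T = carrier_vec n"
proof -
  interpret T: submodule class_ring "span T" V
    using T by (intro span_is_submodule) simp
  let ?z = "lincomb c (S - {y})"
  have "?z \<in> span (S - {y})"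
    using S finite_span[of "S - {y}"] by auto
  also have "\<dots> \<subseteq> span T"
    using rest T by (intro span_is_subset) (auto intro: span_is_submodule)
  finally have z: "?z \<in> span T" .
  have carr: "lincomb c S \<in> carrier_vec n" "?z \<in> carrier_vec n" "y \<in> carrier_vec n"
    using S y by (auto intro!: lincomb_closed)
  have "y = inverse (c y) \<cdot>\<^sub>v lincomb c S + (- inverse (c y)) \<cdot>\<^sub>v ?z"
  proof (rule eq_vecI)
    fix i assume "i < dim_vec (inverse (c y) \<cdot>\<^sub>v lincomb c S + (- inverse (c y)) \<cdot>\<^sub>v ?z)"
    then have i: "i < n" using carr by simp
    have "lincomb c S $ i = c y * y $ i + ?z $ i"
      unfolding lincomb_index[OF i S(3)] lincomb_index[OF i order.trans[OF Diff_subset S(3)]]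
      by (rule sum.remove[OF S(1) y])
    then show "y $ i = (inverse (c y) \<cdot>\<^sub>v lincomb c S + (- inverse (c y)) \<cdot>\<^sub>v ?z) $ i"
      using i carr u(2) by (simp add: field_simps)
  qed (use carr in simp)
  also have "\<dots> \<in> span T"
    using T.m_closed[OF T.smult_closed[OF _ u(1), of "inverse (c y)"] T.smult_closed[OF _ z, of "- inverse (c y)"]]
    by simp
  finally have "S \<subseteq> span T" using rest by blast
  then have "span S \<subseteq> span T"
    using T by (intro span_is_subset) (auto intro: span_is_submodule)
  then show ?thesis
    using S(2) T.subset by auto
qed

section \<open>Expansions in a basis of eigenvectors\<close>

definition eigenlist :: "nat \<Rightarrow> nat \<Rightarrow> (nat \<Rightarrow> real vec) \<Rightarrow> (nat \<Rightarrow> real vec) \<Rightarrow> real vec list" where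
  "eigenlist d l w v = map w [1..<l + 2] @ map v [l + 1..<d + 1]"

lemma set_eigenlist: "set (eigenlist d l w v) = w ` {1..l + 1} \<union> v ` {l + 1..d}"
proof -
  have "{1..<l + 2} = {1..l + 1}" "{l + 1..<d + 1} = {l + 1..d}"
    by auto
  then show ?thesis
    by (simp only: eigenlist_def set_append set_map set_upt)
qed

lemma length_eigenlist: "l \<le> d \<Longrightarrow> length (eigenlist d l w v) = d + 1"
  by (simp add: eigenlist_def del: upt_Suc)

lemma sum_eigenlist:
  assumes "distinct (eigenlist d l w v)"
  shows "(\<Sum>y\<in>set (eigenlist d l w v). g y) = (\<Sum>k=1..l + 1. g (w k)) + (\<Sum>j=l + 1..d. g (v j))"
proof -
  have "inj_on w {1..<l + 2}" "inj_on v {l + 1..<d + 1}" "w ` {1..<l + 2} \<inter> v ` {l + 1..<d + 1} = {}"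
    using assms by (auto simp only: eigenlist_def distinct_append distinct_map set_map set_upt)
  moreover have "{1..<l + 2} = {1..l + 1}" "{l + 1..<d + 1} = {l + 1..d}"
    by auto
  ultimately show ?thesis
    unfolding set_eigenlist by (simp only: sum.union_disjoint sum.reindex finite_imageI finite_atLeastAtMost o_def)
qed

lemma eigenbasis_eigenvectors:
  assumes "eigenbasis d l w v"
  shows "k \<in> {1..l + 1} \<Longrightarrow> eigenvector (H_matrix d l) (w k) 1"
    and "j \<in> {l + 1..d} \<Longrightarrow> eigenvector (H_matrix d l) (v j) (fact j / fact l)"
  using assms by (auto simp: eigenbasis_def)

text \<open>
  The coefficient function \<open>c\<close> is indexed by the basis vectors themselves. It occurs both in an abstract
  linear combination, used for exchange arguments, and in coordinates.
\<close>

lemma eigenbasis_expansion: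
  assumes eb: "eigenbasis d l w v" and x: "x \<in> carrier_vec (d + 1)"
  obtains c where "module.lincomb (module_vec TYPE(real) (d + 1)) c (set (eigenlist d l w v)) = x"
    "\<And>i. i < d + 1 \<Longrightarrow> x $ i = (\<Sum>k=1..l + 1. c (w k) * w k $ i) + (\<Sum>j=l + 1..d. c (v j) * v j $ i)"
proof -
  interpret vec_space "TYPE(real)" "d + 1" .
  let ?S = "set (eigenlist d l w v)"
  have "basis ?S" and dist: "distinct (eigenlist d l w v)"
    using eb by (simp_all only: eigenbasis_def eigenlist_def)
  then have S: "span ?S = carrier_vec (d + 1)" "?S \<subseteq> carrier_vec (d + 1)"
    by (simp_all only: basis_def cV)
  then obtain c where c: "lincomb c ?S = x"
    using x finite_span[of ?S] by auto
  have "x $ i = (\<Sum>k=1..l + 1. c (w k) * w k $ i) + (\<Sum>j=l + 1..d. c (v j) * v j $ i)" if i: "i < d + 1" for i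
    using lincomb_index[OF i S(2), of c] unfolding c sum_eigenlist[OF dist] .
  then show ?thesis using that c by blast
qed

text \<open>
  The common column sum bounds all eigenvalues, so it is at least \<open>d! / l!\<close>. If it were larger, it
  would be none of the eigenvalues that belong to the basis, and the sum of the coordinates would vanish
  on every basis vector, hence identically.
\<close>

lemma column_sum_eq:
  assumes eb: "eigenbasis d l w v" and "l < d"
  shows "real (column_sum d l) = fact d / fact l"
proof (rule antisym)
  note H = H_matrix_carrier[of d l]
  have ld: "l \<le> d" using \<open>l < d\<close> by simp
  note col = H_matrix_column_sum[OF ld]
  have fact_le: "fact j / fact l \<le> (fact d / fact l :: real)" if "j \<le> d" for j
    using that by (intro divide_right_mono fact_mono) auto
  have "\<bar>fact d / fact l\<bar> \<le> real (column_sum d l)"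
    using \<open>l < d\<close> by (intro eigenvalue_abs_le_column_sum[OF H H_matrix_nonneg col
      eigenbasis_eigenvectors(2)[OF eb]]) auto
  then show "fact d / fact l \<le> real (column_sum d l)" by simp
  show "real (column_sum d l) \<le> fact d / fact l"
  proof (rule ccontr)
    assume "\<not> ?thesis"
    then have large: "fact d / fact l < real (column_sum d l)" by simp
    have w: "(\<Sum>i<d + 1. w k $ i) = 0" if "k \<in> {1..l + 1}" for k
      using large fact_le[of l] \<open>l < d\<close>
      by (intro eigenvector_sum_zero[OF H col eigenbasis_eigenvectors(1)[OF eb that]]) auto
    have v: "(\<Sum>i<d + 1. v j $ i) = 0" if "j \<in> {l + 1..d}" for j
      using large fact_le[of j] that
      by (intro eigenvector_sum_zero[OF H col eigenbasis_eigenvectors(2)[OF eb that]]) auto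
    obtain c where "\<And>i. i < d + 1 \<Longrightarrow> unit_vec (d + 1) 0 $ i =
        (\<Sum>k=1..l + 1. c (w k) * w k $ i) + (\<Sum>j=l + 1..d. c (v j) * v j $ i)"
      using eigenbasis_expansion[OF eb unit_vec_carrier] by blast
    then have "(\<Sum>i<d + 1. unit_vec (d + 1) 0 $ i) =
        (\<Sum>i<d + 1. (\<Sum>k=1..l + 1. c (w k) * w k $ i) + (\<Sum>j=l + 1..d. c (v j) * v j $ i))"
      by (intro sum.cong) auto
    also have "\<dots> = (\<Sum>k=1..l + 1. c (w k) * (\<Sum>i<d + 1. w k $ i)) +
        (\<Sum>j=l + 1..d. c (v j) * (\<Sum>i<d + 1. v j $ i))"
      unfolding sum.distrib sum_distrib_left by (intro arg_cong2[where f = "(+)"] sum.swap)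
    also have "\<dots> = 0"
      using w v by (simp del: sum.lessThan_Suc sum.cl_ivl_Suc)
    finally have "(\<Sum>i<d + 1. unit_vec (d + 1) 0 $ i) = (0 :: real)" .
    moreover have "(\<Sum>i<d + 1. unit_vec (d + 1) 0 $ i) = (\<Sum>i<d + 1. if i = 0 then 1 else 0 :: real)"
      by (intro sum.cong) auto
    ultimately show False by (simp del: sum.lessThan_Suc)
  qed
qed

text \<open>
  The sum of the coordinates isolates the top eigenvalue, since all other basis vectors have sum zero.
\<close>

lemma expansion_total:
  assumes eb: "eigenbasis d l w v" and "l < d" "1 \<le> l"
    and x: "\<And>i. i < d + 1 \<Longrightarrow> x $ i = (\<Sum>k=1..l + 1. a k * w k $ i) + (\<Sum>j=l + 1..d. b j * v j $ i)"
  shows "(\<Sum>i<d + 1. x $ i) = b d * (\<Sum>i<d + 1. v d $ i)"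
proof -
  note H = H_matrix_carrier[of d l]
  have ld: "l \<le> d" using \<open>l < d\<close> by simp
  note col = H_matrix_column_sum[OF ld, unfolded column_sum_eq[OF eb \<open>l < d\<close>]]
  have less: "fact j / fact l < (fact d / fact l :: real)" if "j < d" "1 \<le> j" for j
    using that by (intro divide_strict_right_mono fact_less_mono) auto
  have w: "(\<Sum>i<d + 1. w k $ i) = 0" if "k \<in> {1..l + 1}" for k
    using less[of l] assms(2,3)
    by (intro eigenvector_sum_zero[OF H col eigenbasis_eigenvectors(1)[OF eb that]]) auto
  have v: "(\<Sum>i<d + 1. v j $ i) = 0" if "j \<in> {l + 1..d}" "j \<noteq> d" for j
    using less[of j] that
    by (intro eigenvector_sum_zero[OF H col eigenbasis_eigenvectors(2)[OF eb that(1)]]) auto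
  have "(\<Sum>i<d + 1. x $ i) =
      (\<Sum>i<d + 1. (\<Sum>k=1..l + 1. a k * w k $ i) + (\<Sum>j=l + 1..d. b j * v j $ i))"
    using x by (intro sum.cong) auto
  also have "\<dots> = (\<Sum>k=1..l + 1. a k * (\<Sum>i<d + 1. w k $ i)) +
      (\<Sum>j=l + 1..d. b j * (\<Sum>i<d + 1. v j $ i))"
    unfolding sum.distrib sum_distrib_left by (intro arg_cong2[where f = "(+)"] sum.swap)
  also have "(\<Sum>k=1..l + 1. a k * (\<Sum>i<d + 1. w k $ i)) = 0"
    using w by (intro sum.neutral) simp
  also have "(\<Sum>j=l + 1..d. b j * (\<Sum>i<d + 1. v j $ i)) =
      (\<Sum>j=l + 1..d. if j = d then b j * (\<Sum>i<d + 1. v j $ i) else 0)"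
    using v by (intro sum.cong refl) simp
  also have "\<dots> = b d * (\<Sum>i<d + 1. v d $ i)"
    using \<open>l < d\<close> by (simp del: sum.lessThan_Suc sum.cl_ivl_Suc)
  finally show ?thesis by simp
qed

lemma fixed_lincomb:
  fixes A :: "'a::field mat"
  assumes A: "A \<in> carrier_mat n n" and "x \<in> carrier_vec n" "y \<in> carrier_vec n"
    and "A *\<^sub>v x = x" "A *\<^sub>v y = y"
  shows "A *\<^sub>v (a \<cdot>\<^sub>v x + b \<cdot>\<^sub>v y) = a \<cdot>\<^sub>v x + b \<cdot>\<^sub>v y"
  using assms by (simp add: mult_add_distrib_mat_vec[OF A] mult_mat_vec[OF A assms(2)] mult_mat_vec[OF A assms(3)])

text \<open>
  The map to the first and last coordinate is surjective and kills all eigenvectors for eigenvalues other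
  than \<open>1\<close>, so it is already surjective on the eigenspace for \<open>1\<close>. Hence two of the vectors \<open>w k\<close>
  have linearly independent images.
\<close>

lemma independent_end_coordinates:
  assumes eb: "eigenbasis d l w v" and "l < d" "1 \<le> l"
  obtains r s where "r \<in> {1..l + 1}" "s \<in> {1..l + 1}" "w r $ 0 * w s $ d - w r $ d * w s $ 0 \<noteq> 0"
proof -
  have v: "v j $ 0 = 0" "v j $ d = 0" if "j \<in> {l + 1..d}" for j
  proof -
    have "fact l < (fact j :: real)" using that assms(3) by (intro fact_less_mono) auto
    then have "fact j / fact l \<noteq> (1 :: real)" by simp
    then show "v j $ 0 = 0" "v j $ d = 0"
      using eigenvector_ends_zero[OF _ eigenbasis_eigenvectors(2)[OF eb that]] \<open>l < d\<close> by auto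
  qed
  have ends: "\<exists>a. \<forall>i\<in>{0, d}. x $ i = (\<Sum>k=1..l + 1. a k * w k $ i)" if x: "x \<in> carrier_vec (d + 1)" for x
  proof -
    obtain c where c: "\<And>i. i < d + 1 \<Longrightarrow> x $ i =
        (\<Sum>k=1..l + 1. c (w k) * w k $ i) + (\<Sum>j=l + 1..d. c (v j) * v j $ i)"
      using eigenbasis_expansion[OF eb x] by blast
    have "(\<Sum>j=l + 1..d. c (v j) * v j $ i) = 0" if "i \<in> {0, d}" for i
      using that v by (intro sum.neutral) auto
    then show ?thesis using c by (intro exI[of _ "\<lambda>k. c (w k)"]) auto
  qed
  obtain a where a: "(\<Sum>k=1..l + 1. a k * w k $ 0) = 1" "(\<Sum>k=1..l + 1. a k * w k $ d) = 0"
    using ends[of "unit_vec (d + 1) 0"] \<open>l < d\<close> by auto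
  obtain b where b: "(\<Sum>k=1..l + 1. b k * w k $ 0) = 0" "(\<Sum>k=1..l + 1. b k * w k $ d) = 1"
    using ends[of "unit_vec (d + 1) d"] \<open>l < d\<close> by auto
  \<comment> \<open>By bilinearity, the determinant of the two images \<open>(1, 0)\<close> and \<open>(0, 1)\<close> is a combination
    of the minors in question.\<close>
  have "(\<Sum>r=1..l + 1. \<Sum>s=1..l + 1. a r * b s * (w r $ 0 * w s $ d - w r $ d * w s $ 0)) =
      (\<Sum>r=1..l + 1. \<Sum>s=1..l + 1. (a r * w r $ 0) * (b s * w s $ d) - (a r * w r $ d) * (b s * w s $ 0))"
    by (intro sum.cong refl) (simp add: algebra_simps)
  also have "\<dots> = (\<Sum>r=1..l + 1. a r * w r $ 0) * (\<Sum>s=1..l + 1. b s * w s $ d) -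
      (\<Sum>r=1..l + 1. a r * w r $ d) * (\<Sum>s=1..l + 1. b s * w s $ 0)"
    by (simp only: sum_subtractf sum_product)
  also have "\<dots> = 1" unfolding a b by simp
  finally have nonzero:
    "(\<Sum>r=1..l + 1. \<Sum>s=1..l + 1. a r * b s * (w r $ 0 * w s $ d - w r $ d * w s $ 0)) \<noteq> 0"
    by simp
  have "\<exists>r\<in>{1..l + 1}. \<exists>s\<in>{1..l + 1}. w r $ 0 * w s $ d - w r $ d * w s $ 0 \<noteq> 0"
  proof (rule ccontr)
    assume "\<not> ?thesis"
    then have "w r $ 0 * w s $ d - w r $ d * w s $ 0 = 0" if "r \<in> {1..l + 1}" "s \<in> {1..l + 1}" for r s
      using that by blast
    then show False
      using nonzero by (simp del: sum.cl_ivl_Suc)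
  qed
  then show ?thesis using that by blast
qed

section \<open>Exchanging basis vectors\<close>

text \<open>
  Let \<open>w r\<close> and \<open>w s\<close> have independent pairs of outer coordinates. Cramer's rule gives \<open>p\<close> and
  \<open>q\<close> in their span with the pairs \<open>(1, 0)\<close> and \<open>(0, 1)\<close>. The remaining \<open>w k\<close> are corrected
  by multiples of \<open>p\<close> and \<open>q\<close> to have zero outer coordinates. The vector \<open>u\<close> may replace \<open>v d\<close>
  because its coordinate sum is nonzero, so that \<open>v d\<close> occurs in its expansion. All old basis vectors
  lie in the span of the new ones, and the number of vectors is right, so the new family is a basis.
\<close>

lemma exchange_eigenbasis:
  assumes eb: "eigenbasis d l w v" and "l < d" "1 \<le> l"
    and u: "eigenvector (H_matrix d l) u (fact d / fact l)" and total: "(\<Sum>i<d + 1. u $ i) \<noteq> 0"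
  obtains w' where "eigenbasis d l w' (v(d := u))"
    "\<And>k. k \<in> {3..l + 1} \<Longrightarrow> w' k $ 0 = 0 \<and> w' k $ d = 0"
    "w' 1 $ 0 = 1" "w' 1 $ d = 0" "w' 2 $ 0 = 0" "w' 2 $ d = 1"
proof -
  let ?H = "H_matrix d l"
  define n where "n = d + 1"
  have H: "?H \<in> carrier_mat n n"
    unfolding n_def by (rule H_matrix_carrier)
  have bounds [simp]: "0 < n" "d < n"
    by (simp_all add: n_def)
  interpret vec_space "TYPE(real)" n .
  have w: "w k \<in> carrier_vec n" "?H *\<^sub>v w k = w k" if "k \<in> {1..l + 1}" for k
    using eigenbasis_eigenvectors(1)[OF eb that] H by (auto simp: eigenvector_def)
  have v: "v j \<in> carrier_vec n" if "j \<in> {l + 1..d}" for j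
    using eigenbasis_eigenvectors(2)[OF eb that] H by (auto simp: eigenvector_def)
  have u_carrier: "u \<in> carrier_vec n"
    using u H by (auto simp: eigenvector_def)

  obtain r s where rs: "r \<in> {1..l + 1}" "s \<in> {1..l + 1}"
    and D_nonzero: "w r $ 0 * w s $ d - w r $ d * w s $ 0 \<noteq> 0"
    using independent_end_coordinates[OF eb assms(2,3)] .
  define D where "D = w r $ 0 * w s $ d - w r $ d * w s $ 0"
  have D: "D \<noteq> 0" using D_nonzero by (simp add: D_def)
  have "r \<noteq> s" using D_nonzero by auto
  define p where "p = (w s $ d / D) \<cdot>\<^sub>v w r + (- w r $ d / D) \<cdot>\<^sub>v w s"
  define q where "q = (- w s $ 0 / D) \<cdot>\<^sub>v w r + (w r $ 0 / D) \<cdot>\<^sub>v w s"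
  have p: "p \<in> carrier_vec n" "?H *\<^sub>v p = p" and q: "q \<in> carrier_vec n" "?H *\<^sub>v q = q"
    using w[OF rs(1)] w[OF rs(2)] unfolding p_def q_def by (simp_all add: fixed_lincomb[OF H])
  have p_index: "p $ i = (w s $ d * w r $ i - w r $ d * w s $ i) / D"
    and q_index: "q $ i = (w r $ 0 * w s $ i - w s $ 0 * w r $ i) / D" if "i < n" for i
    using that w[OF rs(1)] w[OF rs(2)] by (simp_all add: p_def q_def diff_divide_distrib)
  have p_ends: "p $ 0 = 1" "p $ d = 0" and q_ends: "q $ 0 = 0" "q $ d = 1"
    using D by (simp_all add: p_index q_index) (simp_all add: D_def algebra_simps)
  have wr: "w r = (w r $ 0) \<cdot>\<^sub>v p + (w r $ d) \<cdot>\<^sub>v q"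
  proof (rule eq_vecI)
    fix i assume "i < dim_vec ((w r $ 0) \<cdot>\<^sub>v p + (w r $ d) \<cdot>\<^sub>v q)"
    then have i: "i < n" using q by simp
    have "w r $ 0 * p $ i + w r $ d * q $ i = D * w r $ i / D"
      using i by (simp add: p_index q_index D_def field_simps flip: add_divide_distrib)
    then show "w r $ i = ((w r $ 0) \<cdot>\<^sub>v p + (w r $ d) \<cdot>\<^sub>v q) $ i"
      using D i p q by simp
  qed (use q w[OF rs(1)] in simp)
  have ws: "w s = (w s $ 0) \<cdot>\<^sub>v p + (w s $ d) \<cdot>\<^sub>v q"
  proof (rule eq_vecI)
    fix i assume "i < dim_vec ((w s $ 0) \<cdot>\<^sub>v p + (w s $ d) \<cdot>\<^sub>v q)"
    then have i: "i < n" using q by simp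
    have "w s $ 0 * p $ i + w s $ d * q $ i = D * w s $ i / D"
      using i by (simp add: p_index q_index D_def field_simps flip: add_divide_distrib)
    then show "w s $ i = ((w s $ 0) \<cdot>\<^sub>v p + (w s $ d) \<cdot>\<^sub>v q) $ i"
      using D i p q by simp
  qed (use q w[OF rs(2)] in simp)

  \<comment> \<open>\<open>f\<close> enumerates the indices other than \<open>r\<close> and \<open>s\<close> by \<open>3, \<dots>, l + 1\<close>.\<close>
  have "card {3..l + 1} = card ({1..l + 1} - {r, s})"
    using rs \<open>r \<noteq> s\<close> by (simp add: card_Diff_subset)
  then obtain f where f: "bij_betw f {3..l + 1} ({1..l + 1} - {r, s})"
    using finite_same_card_bij[of "{3..l + 1}" "{1..l + 1} - {r, s}"] by auto
  have f_range: "f k \<in> {1..l + 1}" if "k \<in> {3..l + 1}" for k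
    using bij_betwE[OF f] that by auto
  \<comment> \<open>The factors \<open>1\<close> give both summands the form that \<open>fixed_lincomb\<close> expects.\<close>
  define w' where "w' k = (if k = 1 then p else if k = 2 then q
    else 1 \<cdot>\<^sub>v w (f k) + 1 \<cdot>\<^sub>v ((- w (f k) $ 0) \<cdot>\<^sub>v p + (- w (f k) $ d) \<cdot>\<^sub>v q))" for k
  have w'_cases: "k = 1 \<or> k = 2 \<or> k \<in> {3..l + 1}" if "k \<in> {1..l + 1}" for k
    using that by auto
  have w': "w' k \<in> carrier_vec n \<and> ?H *\<^sub>v w' k = w' k" if "k \<in> {1..l + 1}" for k
  proof (cases "k = 1 \<or> k = 2")
    case True
    then show ?thesis using p q by (auto simp: w'_def)
  next
    case False
    then have wf: "w (f k) \<in> carrier_vec n" "?H *\<^sub>v w (f k) = w (f k)"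
      using w'_cases[OF that] f_range w by blast+
    let ?z = "(- w (f k) $ 0) \<cdot>\<^sub>v p + (- w (f k) $ d) \<cdot>\<^sub>v q"
    have z: "?z \<in> carrier_vec n" "?H *\<^sub>v ?z = ?z"
      using p q fixed_lincomb[OF H p(1) q(1) p(2) q(2)] by simp_all
    have "w' k = 1 \<cdot>\<^sub>v w (f k) + 1 \<cdot>\<^sub>v ?z"
      using False by (auto simp: w'_def)
    moreover have "1 \<cdot>\<^sub>v w (f k) + 1 \<cdot>\<^sub>v ?z \<in> carrier_vec n"
      using wf z by simp
    ultimately show ?thesis
      using fixed_lincomb[OF H wf(1) z(1) wf(2) z(2), of 1 1] by (simp only:)
  qed
  have w'_ends: "w' k $ 0 = 0 \<and> w' k $ d = 0" if "k \<in> {3..l + 1}" for k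
    using w(1)[OF f_range[OF that]] that p q p_ends q_ends by (auto simp: w'_def)

  define v' where "v' = v(d := u)"
  define S where "S = set (eigenlist d l w v)"
  define T where "T = set (eigenlist d l w' v')"
  have "basis S"
    using eb by (simp only: S_def n_def eigenbasis_def eigenlist_def)
  then have S: "finite S" "span S = carrier_vec n" "S \<subseteq> carrier_vec n"
    by (simp_all only: S_def basis_def cV finite_set)
  have T: "T \<subseteq> carrier_vec n"
    using w' v u_carrier by (auto simp: T_def set_eigenlist v'_def simp del: sum.cl_ivl_Suc)
  interpret T: submodule class_ring "span T" V
    using T by (intro span_is_submodule) simp
  have combo: "a \<cdot>\<^sub>v x + b \<cdot>\<^sub>v y \<in> span T" if "x \<in> span T" "y \<in> span T" for a b x y
    using T.m_closed[OF T.smult_closed[OF _ that(1), of a] T.smult_closed[OF _ that(2), of b]] by simp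
  have T_mem: "x \<in> span T" if "x \<in> T" for x
    using in_own_span[of T] T that by auto
  have w'_mem: "w' k \<in> span T" if "k \<in> {1..l + 1}" for k
    using that by (intro T_mem) (auto simp: T_def set_eigenlist)
  have v'_mem: "v' j \<in> span T" if "j \<in> {l + 1..d}" for j
    using that by (intro T_mem) (auto simp: T_def set_eigenlist)
  have pq_mem: "p \<in> span T" "q \<in> span T"
    using w'_mem[of 1] w'_mem[of 2] assms(3) by (simp_all add: w'_def)
  have w_mem: "w k \<in> span T" if "k \<in> {1..l + 1}" for k
  proof (cases "k \<in> {r, s}")
    case True
    then show ?thesis
      using forw_subst[where P = "\<lambda>x. x \<in> span T", OF wr combo[OF pq_mem]]
        forw_subst[where P = "\<lambda>x. x \<in> span T", OF ws combo[OF pq_mem]] by blast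
  next
    case False
    then have "k \<in> f ` {3..l + 1}"
      unfolding bij_betw_imp_surj_on[OF f] using that by blast
    then obtain m where m: "m \<in> {3..l + 1}" "k = f m"
      by blast
    have "w k = 1 \<cdot>\<^sub>v w' m + 1 \<cdot>\<^sub>v ((w k $ 0) \<cdot>\<^sub>v p + (w k $ d) \<cdot>\<^sub>v q)"
      using w(1)[OF that] p(1) q(1) m by (intro eq_vecI) (auto simp: w'_def)
    then show ?thesis
      by (rule forw_subst[where P = "\<lambda>x. x \<in> span T"])
        (use m(1) in \<open>intro combo w'_mem pq_mem; simp\<close>)
  qed
  have rest: "S - {v d} \<subseteq> span T"
  proof
    fix x assume x: "x \<in> S - {v d}"
    then have "x \<in> w ` {1..l + 1} \<or> x \<in> v ` {l + 1..d}"
      by (simp only: S_def set_eigenlist) blast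
    then show "x \<in> span T"
    proof
      assume "x \<in> w ` {1..l + 1}"
      then show ?thesis using w_mem by blast
    next
      assume "x \<in> v ` {l + 1..d}"
      then obtain j where j: "j \<in> {l + 1..d}" "x = v j" by blast
      then have "j \<noteq> d" using x by auto
      then show ?thesis using v'_mem[OF j(1)] j(2) by (simp add: v'_def)
    qed
  qed
  obtain c where c: "lincomb c S = u"
    and c_index: "\<And>i. i < d + 1 \<Longrightarrow> u $ i =
      (\<Sum>k=1..l + 1. c (w k) * w k $ i) + (\<Sum>j=l + 1..d. c (v j) * v j $ i)"
    using eigenbasis_expansion[OF eb] u_carrier unfolding S_def n_def by blast
  have "c (v d) \<noteq> 0"
    using total expansion_total[OF eb assms(2,3) c_index] by auto
  moreover have "lincomb c S \<in> span T"
    using v'_mem[of d] assms(2) by (simp add: c v'_def)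
  moreover have "v d \<in> S"
    using assms(2) by (auto simp: S_def set_eigenlist)
  ultimately have "span T = carrier_vec n"
    using exchange_spans[OF S T _ rest] by blast
  then have basis: "distinct (eigenlist d l w' v')" "basis T"
    using spanning_list_is_basis[of "eigenlist d l w' v'"] T assms(2) length_eigenlist[of l d w' v']
    by (simp_all add: T_def n_def)
  have "(UNIV :: real set) \<noteq> {0}"
    by (metis UNIV_I singletonD zero_neq_one)
  then have "0\<^sub>v n \<notin> T"
    using basis(2) zero_nin_lin_indpt[of T] by (auto simp: basis_def)
  moreover have "w' k \<in> T" if "k \<in> {1..l + 1}" for k
    using that by (auto simp: T_def set_eigenlist)
  ultimately have nonzero: "w' k \<noteq> 0\<^sub>v n" if "k \<in> {1..l + 1}" for k
    using that by metis
  have "eigenvector ?H (w' k) 1" if "k \<in> {1..l + 1}" for k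
    using w'[OF that] nonzero[OF that] H by (auto simp: eigenvector_def)
  moreover have "eigenvector ?H (v' j) (fact j / fact l)" if "j \<in> {l + 1..d}" for j
    using eigenbasis_eigenvectors(2)[OF eb that] u by (simp add: v'_def)
  ultimately have "eigenbasis d l w' v'"
    using basis unfolding eigenbasis_def T_def eigenlist_def n_def by blast
  then show ?thesis
    using that w'_ends p_ends q_ends unfolding v'_def by (simp add: w'_def)
qed

section \<open>The h-vector of a simplicial complex and the eigenvector expansion\<close>

text \<open>
  Put \<open>x = 1\<close> in the identity that defines the \<open>h\<close>-vector: only the top face number survives.
\<close>

lemma sum_h_vector: "(\<Sum>i<d + 1. h_vector d \<Delta> $ i) = real (f_number \<Delta> (int d - 1))"
proof -
  have "(\<Sum>i<d + 1. h_vector d \<Delta> $ i) = (\<Sum>i=0..d. h_vector d \<Delta> $ i * 1 ^ (d - i))"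
    by (simp add: atLeast0AtMost lessThan_Suc_atMost)
  also have "\<dots> = (\<Sum>i=0..d. real (f_number \<Delta> (int i - 1)) * (1 - 1) ^ (d - i))"
    by (rule h_vector_identity[symmetric])
  also have "\<dots> = (\<Sum>i=0..d. if i = d then real (f_number \<Delta> (int i - 1)) else 0)"
    by (intro sum.cong) auto
  also have "\<dots> = real (f_number \<Delta> (int d - 1))"
    by simp
  finally show ?thesis .
qed

lemma top_f_number_pos:
  assumes "simplicial_complex \<Delta>"
  shows "0 < f_number \<Delta> (complex_dim \<Delta>)"
proof -
  have fin: "finite \<Delta>" "\<Delta> \<noteq> {}"
    using assms by (auto simp: simplicial_complex_def)
  then have "complex_dim \<Delta> \<in> face_dim ` \<Delta>"
    unfolding complex_dim_def by (intro Max_in) auto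
  then have "{A \<in> \<Delta>. face_dim A = complex_dim \<Delta>} \<noteq> {}"
    by auto
  then show ?thesis
    using fin by (simp add: f_number_def card_gt_0_iff)
qed

theorem theorem4p10:
  fixes d l :: nat and w v :: "nat \<Rightarrow> real vec"
  assumes "d \<ge> 2" and "1 \<le> l" and "l \<le> d - 1"
    and "eigenbasis d l w v"
  shows
    "(\<forall>\<Delta> :: 'a set set. simplicial_complex \<Delta> \<and> complex_dim \<Delta> = int d - 1 \<longrightarrow>
        (\<exists>a b. h_vector d \<Delta> =
            vec (d + 1) (\<lambda>i. (\<Sum>k=1..l + 1. a k * w k $ i) + (\<Sum>j=l + 1..d. b j * v j $ i))) \<and>
        (\<forall>a b. h_vector d \<Delta> =
            vec (d + 1) (\<lambda>i. (\<Sum>k=1..l + 1. a k * w k $ i) + (\<Sum>j=l + 1..d. b j * v j $ i))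
          \<longrightarrow> b d \<noteq> 0)) \<and>
     (\<forall>j\<in>{l + 1..d}. v j $ 0 = 0 \<and> v j $ d = 0) \<and>
     (\<exists>w' u. eigenbasis d l w' (v(d := u)) \<and>
        (\<forall>k\<in>{3..l + 1}. w' k $ 0 = 0 \<and> w' k $ d = 0) \<and>
        w' 1 $ 0 = 1 \<and> w' 1 $ d = 0 \<and>
        w' 2 $ 0 = 0 \<and> w' 2 $ d = 1 \<and>
        u $ 0 = 0 \<and> u $ d = 0 \<and>
        (\<forall>i\<in>{1..d - 1}. u $ i \<in> \<rat> \<and> u $ i > 0))"
proof (intro conjI allI impI ballI)
  note eb = assms(4)
  have ld: "l < d" "l \<le> d" using assms(1-3) by auto
  note c = column_sum_eq[OF eb ld(1)]
  have ev_not_one: "fact j / fact l \<noteq> (1 :: real)" if "j \<in> {l + 1..d}" for j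
  proof -
    have "fact l < (fact j :: real)" using that assms(2) by (intro fact_less_mono) auto
    then show ?thesis by simp
  qed
  {
    fix \<Delta> :: "'a set set"
    assume \<Delta>: "simplicial_complex \<Delta> \<and> complex_dim \<Delta> = int d - 1"
    have h: "h_vector d \<Delta> \<in> carrier_vec (d + 1)" by (simp add: h_vector_def)
    obtain e where "\<And>i. i < d + 1 \<Longrightarrow> h_vector d \<Delta> $ i =
        (\<Sum>k=1..l + 1. e (w k) * w k $ i) + (\<Sum>j=l + 1..d. e (v j) * v j $ i)"
      using eigenbasis_expansion[OF eb h] by blast
    then have "h_vector d \<Delta> = vec (d + 1)
        (\<lambda>i. (\<Sum>k=1..l + 1. e (w k) * w k $ i) + (\<Sum>j=l + 1..d. e (v j) * v j $ i))"
      using h by (intro eq_vecI) auto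
    then show "\<exists>a b. h_vector d \<Delta> =
        vec (d + 1) (\<lambda>i. (\<Sum>k=1..l + 1. a k * w k $ i) + (\<Sum>j=l + 1..d. b j * v j $ i))"
      by (intro exI[of _ "\<lambda>k. e (w k)"] exI[of _ "\<lambda>j. e (v j)"])
  next
    fix \<Delta> :: "'a set set" and a b :: "nat \<Rightarrow> real"
    assume \<Delta>: "simplicial_complex \<Delta> \<and> complex_dim \<Delta> = int d - 1"
      and h: "h_vector d \<Delta> =
        vec (d + 1) (\<lambda>i. (\<Sum>k=1..l + 1. a k * w k $ i) + (\<Sum>j=l + 1..d. b j * v j $ i))"
    have "0 < (\<Sum>i<d + 1. h_vector d \<Delta> $ i)"
      using top_f_number_pos[of \<Delta>] \<Delta> unfolding sum_h_vector by simp
    also have "\<dots> = b d * (\<Sum>i<d + 1. v d $ i)"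
      by (rule expansion_total[OF eb ld(1) assms(2), of _ a]) (simp add: h)
    finally show "b d \<noteq> 0" by auto
  next
    fix j assume j: "j \<in> {l + 1..d}"
    show "v j $ 0 = 0" "v j $ d = 0"
      using eigenvector_ends_zero[OF ld(2) eigenbasis_eigenvectors(2)[OF eb j] ev_not_one[OF j]] by auto
  }
  have d: "d \<in> {l + 1..d}" using ld by simp
  have "real (column_sum d l) \<noteq> 1"
    unfolding c by (rule ev_not_one[OF d])
  then have "column_sum d l \<noteq> 1" by auto
  then obtain u where u: "eigenvector (H_matrix d l) u (fact d / fact l)"
    and u_pos: "\<And>i. i \<in> {1..d - 1} \<Longrightarrow> u $ i \<in> \<rat> \<and> 0 < u $ i"
    using positive_rational_eigenvector_exists[OF assms(2,3)] unfolding c by blast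
  have u_ends: "u $ 0 = 0" "u $ d = 0"
    using eigenvector_ends_zero[OF ld(2) u ev_not_one[OF d]] by auto
  have "0 < (\<Sum>i<d + 1. u $ i)"
  proof (rule sum_pos2[of _ 1])
    show "0 < u $ 1" using u_pos[of 1] assms(1) by simp
    show "0 \<le> u $ i" if "i \<in> {..<d + 1}" for i
    proof (cases "i = 0 \<or> i = d")
      case True
      then show ?thesis using u_ends by auto
    next
      case False
      then have "i \<in> {1..d - 1}" using that by auto
      then show ?thesis using u_pos[of i] by auto
    qed
  qed (use assms(1) in auto)
  then obtain w' where "eigenbasis d l w' (v(d := u))"
    "\<And>k. k \<in> {3..l + 1} \<Longrightarrow> w' k $ 0 = 0 \<and> w' k $ d = 0"
    "w' 1 $ 0 = 1" "w' 1 $ d = 0" "w' 2 $ 0 = 0" "w' 2 $ d = 1"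
    using exchange_eigenbasis[OF eb ld(1) assms(2) u] by auto
  then show "\<exists>w' u. eigenbasis d l w' (v(d := u)) \<and>
        (\<forall>k\<in>{3..l + 1}. w' k $ 0 = 0 \<and> w' k $ d = 0) \<and>
        w' 1 $ 0 = 1 \<and> w' 1 $ d = 0 \<and>
        w' 2 $ 0 = 0 \<and> w' 2 $ d = 1 \<and>
        u $ 0 = 0 \<and> u $ d = 0 \<and>
        (\<forall>i\<in>{1..d - 1}. u $ i \<in> \<rat> \<and> u $ i > 0)"
    using u_ends u_pos by (intro exI[of _ w'] exI[of _ u]) simp
qed

end
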